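(* Let $Q$ be one of the quadratic spline quasi-interpolants $S_2$, $W_2^*$ on $\Omega$. There exists a constant $C_1>0$, with $C_1\le 3$ for $Q=S_2$ and $C_1\le 2$ for $Q=W_2^*$, such that, for every $f\in C^1(\Omega)$, $$\|f-Qf\|_\Omega\le C_1\,h\,\omega\left(Df,h/2\right).$$
   Context: Partition. Let $m,n\ge 1$ be integers, $\Omega=[a,b]\times[c,d]$, $a=x_0<x_1<\dots<x_m=b$ and $c=y_0<y_1<\dots<y_n=d$, with the conventions $x_{-1}=x_0$, $x_{m+1}=x_m$, $y_{-1}=y_0$, $y_{n+1}=y_n$. Put $h_i=x_i-x_{i-1}$, $k_j=y_j-y_{j-1}$ (so $h_0=h_{m+1}=k_0=k_{n+1}=0$), $s_i=\frac12(x_{i-1}+x_i)$, $t_j=\frac12(y_{j-1}+y_j)$ for $0\le i\le m+1$, $0\le j\le n+1$. Put $M_{i,j}=(s_i,t_j)$ for these indices and $A_{i,j}=(x_i,y_j)$ for $-1\le i\le m+1$, $-1\le j\le n+1$. The criss-cross triangulation $\mathcal T_{mn}$ of $\Omega$ is obtained by drawing both diagonals in each subrectangle $\Omega_{ij}=[x_{i-1},x_i]\times[y_{j-1},y_j]$, $1\le i\le m$, $1\le j\le n$. B-splines. Choose extended knots $u_{-2}<u_{-1}<u_0<\dots<u_m<u_{m+1}<u_{m+2}$ with $u_i=x_i$ for $0\le i\le m$, and $v_{-2}<v_{-1}<v_0<\dots<v_n<v_{n+1}<v_{n+2}$ with $v_j=y_j$ for $0\le j\le n$. For $0\le i\le m+1$,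 $0\le j\le n+1$, the classical B-spline $\overline B_{ij}$ is the unique $C^1$ function on $\mathbb R^2$ that is a polynomial of total degree at most 2 on each triangle of the criss-cross triangulation (both diagonals in each subrectangle) of the grid $\{u_p\}\times\{v_q\}$, vanishes outside the octagon with vertices $(u_{i-2},v_{j-1}),(u_{i-2},v_j),(u_{i-1},v_{j+1}),(u_i,v_{j+1}),(u_{i+1},v_j),(u_{i+1},v_{j-1}),(u_i,v_{j-2}),(u_{i-1},v_{j-2})$, and is normalized by $\overline B_{ij}(u_i,v_j)=\frac{u_{i+1}-u_i}{u_{i+1}-u_{i-1}}\cdot\frac{v_{j+1}-v_j}{v_{j+1}-v_{j-1}}$. Let $\bar h_0=u_0-u_{-1}$, $\bar h_{m+1}=u_{m+1}-u_m$, $\bar k_0=v_0-v_{-1}$, $\bar k_{n+1}=v_{n+1}-v_n$. Define $\alpha_{00}=\frac{\bar h_0+h_1}{h_1}$, $\alpha_{m+1,m+1}=\frac{h_m+\bar h_{m+1}}{h_m}$, $\alpha_{ii}=1$ for $1\le i\le m$, $\alpha_{1,0}=-\frac{\bar h_0}{h_1}$, $\alpha_{m,m+1}=-\frac{\bar h_{m+1}}{h_m}$, all other $\alpha_{ip}=0$; and define $\beta_{jq}$ in the same way with $n,k,\bar k$ in place of $m,h,\bar h$. The B-spline $B_{ij}$ is the restriction to $\Omega$ of $\sum_{p=0}^{m+1}\sum_{q=0}^{n+1}\alpha_{ip}\beta_{jq}\overline B_{pq}$. The functions $B_{ij}$ are nonnegative, have supports in $\Omega$, and sum to 1. Quasi-interpolants.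 For $2\le i\le m$ put $\sigma_i=\frac{h_i}{h_{i-1}+h_i}$, $\sigma_i'=1-\sigma_i$; for $2\le j\le n$ put $\tau_j=\frac{k_j}{k_{j-1}+k_j}$, $\tau_j'=1-\tau_j$; and $\sigma_1=\sigma'_{m+1}=\tau_1=\tau'_{n+1}=1$, $\sigma_1'=\sigma_{m+1}=\tau_1'=\tau_{n+1}=0$. For $1\le i\le m$, $1\le j\le n$, $$a_i=-\frac{\sigma_i^2\sigma_{i+1}'}{\sigma_i+\sigma_{i+1}'},\quad c_i=-\frac{\sigma_i(\sigma_{i+1}')^2}{\sigma_i+\sigma_{i+1}'},\quad \bar a_j=-\frac{\tau_j^2\tau_{j+1}'}{\tau_j+\tau_{j+1}'},\quad \bar c_j=-\frac{\tau_j(\tau_{j+1}')^2}{\tau_j+\tau_{j+1}'},$$ and $a_0=c_0=a_{m+1}=c_{m+1}=\bar a_0=\bar c_0=\bar a_{n+1}=\bar c_{n+1}=0$; $b_{ij}=1-(a_i+c_i+\bar a_j+\bar c_j)$. Then $S_2f=\sum_{i=0}^{m+1}\sum_{j=0}^{n+1}\mu_{ij}(f)B_{ij}$ with $\mu_{ij}(f)=b_{ij}f(M_{i,j})+a_if(M_{i-1,j})+c_if(M_{i+1,j})+\bar a_jf(M_{i,j-1})+\bar c_jf(M_{i,j+1})$ (terms with zero coefficient are omitted), and $W_2^*f=\sum_{i=0}^{m+1}\sum_{j=0}^{n+1}\mu^*_{ij}(f)B_{ij}$ with $\mu^*_{ij}(f)=2f(M_{i,j})-\frac14[f(A_{i-1,j-1})+f(A_{i-1,j})+f(A_{i,j-1})+f(A_{i,j})]$.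 Notation. $h=\max\{h_i,k_j: 1\le i\le m,\,1\le j\le n\}$; $\|\cdot\|_\Omega$ is the supremum norm over $\Omega$; for $\psi\in C(\Omega)$, $\omega(\psi,t)=\max\{|\psi(M)-\psi(P)|: M,P\in\Omega,\ \|MP\|\le t\}$, where $\|MP\|$ is the Euclidean distance; $D^\alpha=\frac{\partial^{|\alpha|}}{\partial x^{\alpha_1}\partial y^{\alpha_2}}$ with $|\alpha|=\alpha_1+\alpha_2$; $\omega(D^sf,t)=\max\{\omega(D^\alpha f,t):|\alpha|=s\}$ and $Df=D^1f$. *)

theory Defs
  imports "HOL-Analysis.Analysis"
begin

section \<open>Smoothness and moduli of continuity on planar sets\<close>

text \<open>
  Partial derivatives are taken along the sections of \<open>S\<close>, so they are one-sided at
  boundary points of a rectangle and the ordinary ones if \<open>S = UNIV\<close>.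
\<close>

definition x_section :: "(real \<times> real) set \<Rightarrow> real \<Rightarrow> real set" where
  "x_section S y = {x. (x, y) \<in> S}"

definition y_section :: "(real \<times> real) set \<Rightarrow> real \<Rightarrow> real set" where
  "y_section S x = {y. (x, y) \<in> S}"

definition partial_x :: "(real \<times> real) set \<Rightarrow> (real \<times> real \<Rightarrow> real) \<Rightarrow> real \<times> real \<Rightarrow> real" where
  "partial_x S f = (\<lambda>(x, y). vector_derivative (\<lambda>s. f (s, y)) (at x within x_section S y))"

definition partial_y :: "(real \<times> real) set \<Rightarrow> (real \<times> real \<Rightarrow> real) \<Rightarrow> real \<times> real \<Rightarrow> real" where
  "partial_y S f = (\<lambda>(x, y). vector_derivative (\<lambda>t. f (x, t)) (at y within y_section S x))"

definition partial_deriv ::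
    "(real \<times> real) set \<Rightarrow> nat \<times> nat \<Rightarrow> (real \<times> real \<Rightarrow> real) \<Rightarrow> real \<times> real \<Rightarrow> real" where
  "partial_deriv S \<alpha> f = (partial_x S ^^ fst \<alpha>) ((partial_y S ^^ snd \<alpha>) f)"

definition C1_on :: "(real \<times> real) set \<Rightarrow> (real \<times> real \<Rightarrow> real) \<Rightarrow> bool" where
  "C1_on S f \<longleftrightarrow>
     continuous_on S f \<and>
     (\<forall>(x, y)\<in>S. (\<lambda>s. f (s, y)) differentiable (at x within x_section S y)) \<and>
     (\<forall>(x, y)\<in>S. (\<lambda>t. f (x, t)) differentiable (at y within y_section S x)) \<and>
     continuous_on S (partial_x S f) \<and>
     continuous_on S (partial_y S f)"

definition sup_norm :: "(real \<times> real) set \<Rightarrow> (real \<times> real \<Rightarrow> real) \<Rightarrow> real" where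
  "sup_norm S g = (SUP P\<in>S. \<bar>g P\<bar>)"

text \<open>
  The metric on \<open>real \<times> real\<close> is the Euclidean one.  For continuous \<open>\<psi>\<close>, compact
  nonempty \<open>S\<close> and \<open>t \<ge> 0\<close> the suprema in \<open>sup_norm\<close> and \<open>modulus\<close> are maxima.
\<close>

definition modulus :: "(real \<times> real) set \<Rightarrow> (real \<times> real \<Rightarrow> real) \<Rightarrow> real \<Rightarrow> real" where
  "modulus S \<psi> t = Sup {\<bar>\<psi> M - \<psi> P\<bar> | M P. M \<in> S \<and> P \<in> S \<and> dist M P \<le> t}"

definition modulus_deriv ::
    "(real \<times> real) set \<Rightarrow> nat \<Rightarrow> (real \<times> real \<Rightarrow> real) \<Rightarrow> real \<Rightarrow> real" where
  "modulus_deriv S s f t =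
     Max ((\<lambda>\<alpha>. modulus S (partial_deriv S \<alpha> f) t) ` {\<alpha>. fst \<alpha> + snd \<alpha> = s})"


section \<open>Partitions\<close>

definition is_partition :: "int \<Rightarrow> real \<Rightarrow> real \<Rightarrow> (int \<Rightarrow> real) \<Rightarrow> bool" where
  "is_partition m a b x \<longleftrightarrow> 1 \<le> m \<and> x 0 = a \<and> x m = b \<and> strict_mono_on {0..m} x"

text \<open>Only \<open>x 0, \<dots>, x m\<close> are used; \<open>node\<close> encodes the conventions
  \<open>x\<^sub>-\<^sub>1 = x\<^sub>0\<close> and \<open>x\<^sub>m\<^sub>+\<^sub>1 = x\<^sub>m\<close>.\<close>

definition node :: "int \<Rightarrow> (int \<Rightarrow> real) \<Rightarrow> int \<Rightarrow> real" where
  "node m x i = x (max 0 (min m i))"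

definition step :: "int \<Rightarrow> (int \<Rightarrow> real) \<Rightarrow> int \<Rightarrow> real" where
  "step m x i = node m x i - node m x (i - 1)"

definition midpt :: "int \<Rightarrow> (int \<Rightarrow> real) \<Rightarrow> int \<Rightarrow> real" where
  "midpt m x i = (node m x (i - 1) + node m x i) / 2"

definition mesh_size :: "int \<Rightarrow> int \<Rightarrow> (int \<Rightarrow> real) \<Rightarrow> (int \<Rightarrow> real) \<Rightarrow> real" where
  "mesh_size m n x y = Max (step m x ` {1..m} \<union> step n y ` {1..n})"

definition extends_partition :: "int \<Rightarrow> (int \<Rightarrow> real) \<Rightarrow> (int \<Rightarrow> real) \<Rightarrow> bool" where
  "extends_partition m x u \<longleftrightarrow> strict_mono_on {-2..m+2} u \<and> (\<forall>i\<in>{0..m}. u i = x i)"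


section \<open>Quadratic B-splines on the criss-cross triangulation\<close>

text \<open>The four triangles cut out of \<open>[x0, x1] \<times> [y0, y1]\<close> by its diagonals.\<close>

definition criss_cross_cell :: "real \<Rightarrow> real \<Rightarrow> real \<Rightarrow> real \<Rightarrow> (real \<times> real) set set" where
  "criss_cross_cell x0 x1 y0 y1 =
     (let z = ((x0 + x1) / 2, (y0 + y1) / 2) in
      {convex hull {z, (x0, y0), (x1, y0)}, convex hull {z, (x1, y0), (x1, y1)},
       convex hull {z, (x1, y1), (x0, y1)}, convex hull {z, (x0, y1), (x0, y0)}})"

definition criss_cross ::
    "int \<Rightarrow> int \<Rightarrow> (int \<Rightarrow> real) \<Rightarrow> (int \<Rightarrow> real) \<Rightarrow> (real \<times> real) set set" where
  "criss_cross m n u v =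
     (\<Union>p\<in>{-1..m+2}. \<Union>q\<in>{-1..n+2}. criss_cross_cell (u (p - 1)) (u p) (v (q - 1)) (v q))"

definition poly_deg_le_on ::
    "nat \<Rightarrow> (real \<times> real) set \<Rightarrow> (real \<times> real \<Rightarrow> real) \<Rightarrow> bool" where
  "poly_deg_le_on d T g \<longleftrightarrow>
     (\<exists>c :: nat \<Rightarrow> nat \<Rightarrow> real. \<forall>(x, y)\<in>T. g (x, y) = (\<Sum>k\<le>d. \<Sum>l\<le>d - k. c k l * x ^ k * y ^ l))"

definition octagon :: "(int \<Rightarrow> real) \<Rightarrow> (int \<Rightarrow> real) \<Rightarrow> int \<Rightarrow> int \<Rightarrow> (real \<times> real) set" where
  "octagon u v i j = convex hull
     {(u (i - 2), v (j - 1)), (u (i - 2), v j), (u (i - 1), v (j + 1)), (u i, v (j + 1)),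
      (u (i + 1), v j), (u (i + 1), v (j - 1)), (u i, v (j - 2)), (u (i - 1), v (j - 2))}"

definition is_classical_bspline ::
    "int \<Rightarrow> int \<Rightarrow> (int \<Rightarrow> real) \<Rightarrow> (int \<Rightarrow> real) \<Rightarrow> int \<Rightarrow> int \<Rightarrow> (real \<times> real \<Rightarrow> real) \<Rightarrow> bool" where
  "is_classical_bspline m n u v i j B \<longleftrightarrow>
     C1_on UNIV B \<and>
     (\<forall>T\<in>criss_cross m n u v. poly_deg_le_on 2 T B) \<and>
     (\<forall>P. P \<notin> octagon u v i j \<longrightarrow> B P = 0) \<and>
     B (u i, v j) = (u (i + 1) - u i) / (u (i + 1) - u (i - 1)) *
                    ((v (j + 1) - v j) / (v (j + 1) - v (j - 1)))"

text \<open>\<open>alpha m u\<close> is the matrix \<open>\<alpha>\<close>, and \<open>alpha n v\<close> is \<open>\<beta>\<close>.  As \<open>u\<close> extends the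
  partition, \<open>h\<^sub>1 = u 1 - u 0\<close> and \<open>h\<^sub>m = u m - u (m - 1)\<close>.\<close>

definition alpha :: "int \<Rightarrow> (int \<Rightarrow> real) \<Rightarrow> int \<Rightarrow> int \<Rightarrow> real" where
  "alpha m u i p =
     (let hbar0 = u 0 - u (-1); h1 = u 1 - u 0;
          hm = u m - u (m - 1); hbarm1 = u (m + 1) - u m in
      if i = 0 \<and> p = 0 then (hbar0 + h1) / h1
      else if i = m + 1 \<and> p = m + 1 then (hm + hbarm1) / hm
      else if 1 \<le> i \<and> i \<le> m \<and> p = i then 1
      else if i = 1 \<and> p = 0 then - (hbar0 / h1)
      else if i = m \<and> p = m + 1 then - (hbarm1 / hm)
      else 0)"

text \<open>The B-splines \<open>B\<^sub>i\<^sub>j\<close>, built from the classical ones \<open>Bbar\<close>.  They and the operators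
  below are only ever evaluated at points of \<open>\<Omega>\<close>, hence the restriction is left implicit.\<close>

definition bspline ::
    "int \<Rightarrow> int \<Rightarrow> (int \<Rightarrow> real) \<Rightarrow> (int \<Rightarrow> real) \<Rightarrow> (int \<Rightarrow> int \<Rightarrow> real \<times> real \<Rightarrow> real) \<Rightarrow>
     int \<Rightarrow> int \<Rightarrow> real \<times> real \<Rightarrow> real" where
  "bspline m n u v Bbar i j P =
     (\<Sum>p=0..m+1. \<Sum>q=0..n+1. alpha m u i p * alpha n v j q * Bbar p q P)"


section \<open>Quasi-interpolants\<close>

definition sigma :: "int \<Rightarrow> (int \<Rightarrow> real) \<Rightarrow> int \<Rightarrow> real" where
  "sigma m x i =
     (if i = 1 then 1
      else if 2 \<le> i \<and> i \<le> m then step m x i / (step m x (i - 1) + step m x i)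
      else 0)"

definition sigma' :: "int \<Rightarrow> (int \<Rightarrow> real) \<Rightarrow> int \<Rightarrow> real" where
  "sigma' m x i = 1 - sigma m x i"

definition coef_a :: "int \<Rightarrow> (int \<Rightarrow> real) \<Rightarrow> int \<Rightarrow> real" where
  "coef_a m x i =
     (if 1 \<le> i \<and> i \<le> m
      then - ((sigma m x i)\<^sup>2 * sigma' m x (i + 1) / (sigma m x i + sigma' m x (i + 1)))
      else 0)"

definition coef_c :: "int \<Rightarrow> (int \<Rightarrow> real) \<Rightarrow> int \<Rightarrow> real" where
  "coef_c m x i =
     (if 1 \<le> i \<and> i \<le> m
      then - (sigma m x i * (sigma' m x (i + 1))\<^sup>2 / (sigma m x i + sigma' m x (i + 1)))
      else 0)"

definition coef_b :: "int \<Rightarrow> int \<Rightarrow> (int \<Rightarrow> real) \<Rightarrow> (int \<Rightarrow> real) \<Rightarrow> int \<Rightarrow> int \<Rightarrow> real" where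
  "coef_b m n x y i j = 1 - (coef_a m x i + coef_c m x i + coef_a n y j + coef_c n y j)"

definition mu ::
    "int \<Rightarrow> int \<Rightarrow> (int \<Rightarrow> real) \<Rightarrow> (int \<Rightarrow> real) \<Rightarrow> (real \<times> real \<Rightarrow> real) \<Rightarrow> int \<Rightarrow> int \<Rightarrow> real" where
  "mu m n x y f i j =
     (let M = (\<lambda>i j. (midpt m x i, midpt n y j)) in
      coef_b m n x y i j * f (M i j)
      + coef_a m x i * f (M (i - 1) j) + coef_c m x i * f (M (i + 1) j)
      + coef_a n y j * f (M i (j - 1)) + coef_c n y j * f (M i (j + 1)))"

definition mu_star ::
    "int \<Rightarrow> int \<Rightarrow> (int \<Rightarrow> real) \<Rightarrow> (int \<Rightarrow> real) \<Rightarrow> (real \<times> real \<Rightarrow> real) \<Rightarrow> int \<Rightarrow> int \<Rightarrow> real" where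
  "mu_star m n x y f i j =
     (let A = (\<lambda>i j. (node m x i, node n y j)) in
      2 * f (midpt m x i, midpt n y j)
      - 1 / 4 * (f (A (i - 1) (j - 1)) + f (A (i - 1) j) + f (A i (j - 1)) + f (A i j)))"

definition S2 ::
    "int \<Rightarrow> int \<Rightarrow> (int \<Rightarrow> real) \<Rightarrow> (int \<Rightarrow> real) \<Rightarrow> (int \<Rightarrow> real) \<Rightarrow> (int \<Rightarrow> real) \<Rightarrow>
     (int \<Rightarrow> int \<Rightarrow> real \<times> real \<Rightarrow> real) \<Rightarrow> (real \<times> real \<Rightarrow> real) \<Rightarrow> real \<times> real \<Rightarrow> real" where
  "S2 m n x y u v Bbar f P =
     (\<Sum>i=0..m+1. \<Sum>j=0..n+1. mu m n x y f i j * bspline m n u v Bbar i j P)"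

definition W2_star ::
    "int \<Rightarrow> int \<Rightarrow> (int \<Rightarrow> real) \<Rightarrow> (int \<Rightarrow> real) \<Rightarrow> (int \<Rightarrow> real) \<Rightarrow> (int \<Rightarrow> real) \<Rightarrow>
     (int \<Rightarrow> int \<Rightarrow> real \<times> real \<Rightarrow> real) \<Rightarrow> (real \<times> real \<Rightarrow> real) \<Rightarrow> real \<times> real \<Rightarrow> real" where
  "W2_star m n x y u v Bbar f P =
     (\<Sum>i=0..m+1. \<Sum>j=0..n+1. mu_star m n x y f i j * bspline m n u v Bbar i j P)"

end

theory Submission
  imports Defs
begin

text \<open>
  A \<open>C\<^sup>1\<close> quadratic spline on a cell cut by its two diagonals is determined by its Bernstein
  coefficients on the boundary of the cell, with nonnegative weights.  On the grid lines the support
  condition forces a classical B-spline to be the tensor product of univariate quadratic B-splines.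
  Hence the \<open>B\<^sub>i\<^sub>j\<close> are nonnegative, sum to \<open>1\<close>, and reproduce
  \<open>x = \<Sum> s\<^sub>i B\<^sub>i\<^sub>j\<close> and \<open>x\<^sup>2 = \<Sum> x\<^sub>i\<^sub>-\<^sub>1 x\<^sub>i B\<^sub>i\<^sub>j\<close>, so that
  \<open>\<Sum> (s\<^sub>i - x)\<^sup>2 B\<^sub>i\<^sub>j = \<Sum> h\<^sub>i\<^sup>2 B\<^sub>i\<^sub>j / 4 \<le> h\<^sup>2 / 4\<close>, and likewise in \<open>y\<close>.

  Choose a linear function whose gradient is at the centre of the range of \<open>Df\<close> near \<open>P\<close>.  It approximates
  \<open>f (M)\<close> up to \<open>\<omega> (2 \<bar>M - P\<bar>\<^sup>2 / h + h / 4)\<close>, and averaging over the \<open>M\<^sub>i\<^sub>j\<close> gives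
  \<open>\<bar>f (P) - \<Sum> f (M\<^sub>i\<^sub>j) B\<^sub>i\<^sub>j (P)\<bar> \<le> 5/4 h \<omega>\<close>.  The functionals \<open>\<mu>\<^sub>i\<^sub>j\<close> and \<open>\<mu>\<^sup>*\<^sub>i\<^sub>j\<close>
  differ from \<open>f (M\<^sub>i\<^sub>j)\<close> by second differences, bounded by \<open>3/2 h \<omega>\<close> and \<open>3/4 h \<omega>\<close>.
  The constants are therefore \<open>11/4\<close> and \<open>2\<close>.
\<close>

section \<open>Moduli of continuity and linear approximation\<close>

text \<open>The derivative in x at the point and continuity of the y-partial yield the total
  derivative; convexity of \<open>Y\<close> supplies the segments for the underlying mean value
  argument.\<close>

lemma C1_on_has_derivative:
  fixes X Y :: "real set"
  assumes f: "C1_on (X \<times> Y) f" and Y: "convex Y" and xy: "x \<in> X" "y \<in> Y"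
  shows "(f has_derivative
           (\<lambda>(s, t). s * partial_x (X \<times> Y) f (x, y) + t * partial_y (X \<times> Y) f (x, y)))
         (at (x, y) within X \<times> Y)"
proof -
  have sx: "x_section (X \<times> Y) y' = X" if "y' \<in> Y" for y'
    using that by (auto simp: x_section_def)
  have sy: "y_section (X \<times> Y) x' = Y" if "x' \<in> X" for x'
    using that by (auto simp: y_section_def)
  have fx: "((\<lambda>s. f (s, y)) has_derivative (\<lambda>s. s * partial_x (X \<times> Y) f (x, y))) (at x within X)"
  proof -
    have "(\<lambda>s. f (s, y)) differentiable (at x within X)"
      using f xy unfolding C1_on_def
      by (metis (mono_tags, lifting) SigmaI case_prodD sx)
    then show ?thesis
      using sx[of y] xy by (simp add: vector_derivative_works has_vector_derivative_def partial_x_def)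
  qed
  \<comment> \<open>The y-partial is packaged as a bounded linear operator, because its continuity
    enters in operator norm.\<close>
  have fy: "((\<lambda>t. f (x', t)) has_derivative
              blinfun_apply (blinfun_scaleR_left (partial_y (X \<times> Y) f (x', y')))) (at y' within Y)"
    if "x' \<in> X" "y' \<in> Y" for x' y'
  proof -
    have "(\<lambda>t. f (x', t)) differentiable (at y' within Y)"
      using f that unfolding C1_on_def
      by (metis (mono_tags, lifting) SigmaI case_prodD sy)
    then show ?thesis
      using sy[of x'] that
      by (simp add: vector_derivative_works has_vector_derivative_def partial_y_def)
  qed
  have "continuous_on (X \<times> Y) (partial_y (X \<times> Y) f)"
    using f by (simp add: C1_on_def)
  then have "continuous_on (X \<times> Y) (\<lambda>p. blinfun_scaleR_left (partial_y (X \<times> Y) f p))"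
    by (intro continuous_intros)
  then have "continuous (at (x, y) within X \<times> Y)
               (\<lambda>(x, y). blinfun_scaleR_left (partial_y (X \<times> Y) f (x, y)))"
    using xy by (simp add: continuous_on_eq_continuous_within case_prod_unfold)
  from has_derivative_partialsI[OF fx fy this xy(2) Y] show ?thesis
    by (simp add: case_prod_unfold)
qed

section \<open>Oscillation bounds beyond the basic distance\<close>

text \<open>Induction on the number of pieces: the point \<open>Q\<close> at fraction
  \<open>N / (N + 1)\<close> of the segment from \<open>M\<close> to \<open>P\<close> leaves a last
  piece of length at most \<open>\<delta>\<close>, and convexity keeps \<open>Q\<close> in
  \<open>S\<close>.\<close>

lemma bounded_increment_chain:
  fixes S :: "'a::real_normed_vector set" and F :: "'a \<Rightarrow> real"
  assumes S: "convex S" and \<delta>: "\<delta> > 0"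
    and F: "\<And>M P. M \<in> S \<Longrightarrow> P \<in> S \<Longrightarrow> dist M P \<le> \<delta> \<Longrightarrow> \<bar>F M - F P\<bar> \<le> w"
    and MP: "M \<in> S" "P \<in> S" "dist M P \<le> real N * \<delta>"
  shows "\<bar>F M - F P\<bar> \<le> real N * w"
  using MP
proof (induction N arbitrary: P)
  case 0
  then show ?case by simp
next
  case (Suc N)
  define Q where "Q = (1 / (real N + 1)) *\<^sub>R M + (real N / (real N + 1)) *\<^sub>R P"
  have "Q \<in> S"
    using S Suc.prems unfolding Q_def
    by (intro convexD[OF S]) (auto simp: field_simps)
  have split: "(1 / (real N + 1)) *\<^sub>R Z + (real N / (real N + 1)) *\<^sub>R Z = Z" for Z :: 'a
    by (simp add: scaleR_add_left[symmetric] add_divide_distrib[symmetric] add.commute[of 1])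
  have "P - Q = (1 / (real N + 1)) *\<^sub>R (P - M)"
    using split[of P] by (simp add: Q_def scaleR_diff_right diff_eq_eq eq_diff_eq ac_simps)
  then have "dist Q P = dist M P / (real N + 1)"
    by (simp add: dist_norm norm_minus_commute[of Q P] norm_minus_commute[of P M])
  then have "dist Q P \<le> \<delta>"
    using Suc.prems by (simp add: pos_divide_le_eq algebra_simps)
  have "M - Q = (real N / (real N + 1)) *\<^sub>R (M - P)"
    using split[of M] by (simp add: Q_def scaleR_diff_right diff_eq_eq eq_diff_eq ac_simps)
  then have "dist M Q = real N / (real N + 1) * dist M P"
    by (simp add: dist_norm)
  also have "\<dots> \<le> real N / (real N + 1) * (real (Suc N) * \<delta>)"
    using Suc.prems by (intro mult_left_mono) auto
  also have "\<dots> = real N * \<delta>"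
    by (simp add: divide_simps)
  finally have "\<bar>F M - F Q\<bar> \<le> real N * w"
    using Suc.IH \<open>Q \<in> S\<close> Suc.prems by blast
  moreover have "\<bar>F Q - F P\<bar> \<le> w"
    using F \<open>Q \<in> S\<close> \<open>dist Q P \<le> \<delta>\<close> Suc.prems by blast
  ultimately show ?case
    by (simp add: algebra_simps)
qed

text \<open>Rounding \<open>dist M P / \<delta>\<close> up to a whole number of pieces costs at most
  one piece, hence the summand 1.\<close>

lemma bounded_increment_linear:
  fixes S :: "'a::real_normed_vector set" and F :: "'a \<Rightarrow> real"
  assumes S: "convex S" and \<delta>: "\<delta> > 0"
    and F: "\<And>M P. M \<in> S \<Longrightarrow> P \<in> S \<Longrightarrow> dist M P \<le> \<delta> \<Longrightarrow> \<bar>F M - F P\<bar> \<le> w"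
    and MP: "M \<in> S" "P \<in> S"
  shows "\<bar>F M - F P\<bar> \<le> (1 + dist M P / \<delta>) * w"
proof -
  define N where "N = nat \<lceil>dist M P / \<delta>\<rceil>"
  have "w \<ge> 0"
    using F[OF MP(1) MP(1)] \<delta> by simp
  have "dist M P / \<delta> \<le> real N"
    unfolding N_def by (rule real_nat_ceiling_ge)
  then have "\<bar>F M - F P\<bar> \<le> real N * w"
    using \<delta> F MP by (intro bounded_increment_chain[OF S \<delta>]) (auto simp: pos_divide_le_eq)
  also have "real N \<le> 1 + dist M P / \<delta>"
  proof -
    have "0 \<le> dist M P / \<delta>"
      using \<delta> by simp
    then show ?thesis unfolding N_def by linarith
  qed
  then have "real N * w \<le> (1 + dist M P / \<delta>) * w"
    using \<open>w \<ge> 0\<close> by (intro mult_right_mono)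
  finally show ?thesis .
qed

text \<open>Subtracting the centre \<open>c\<close> of the range instead of \<open>F P\<close> halves the constant term of
  the bound.\<close>

lemma bounded_increment_centre:
  fixes S :: "'a::real_normed_vector set" and F :: "'a \<Rightarrow> real"
  assumes S: "convex S" and \<delta>: "\<delta> > 0"
    and F: "\<And>M P. M \<in> S \<Longrightarrow> P \<in> S \<Longrightarrow> dist M P \<le> \<delta> \<Longrightarrow> \<bar>F M - F P\<bar> \<le> w"
    and P: "P \<in> S"
  obtains c where "\<And>Z. Z \<in> S \<Longrightarrow> \<bar>F Z - c\<bar> \<le> (1 / 2 + dist Z P / \<delta>) * w"
proof
  \<comment> \<open>\<open>G\<close> is \<open>F\<close> minus the growth permitted away from
    \<open>P\<close>. Its supremum exceeds \<open>F\<close> plus that growth by at most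
    \<open>w\<close> at every point, so the shift by \<open>w / 2\<close> balances the two one-sided
    bounds.\<close>
  define G where "G Z = F Z - dist Z P / \<delta> * w" for Z
  define c where "c = (SUP Z\<in>S. G Z) - w / 2"
  have "w \<ge> 0"
    using F[OF P P] \<delta> by simp
  have G: "G Z' \<le> F Z + dist Z P / \<delta> * w + w" if "Z \<in> S" "Z' \<in> S" for Z Z'
  proof -
    have "\<bar>F Z' - F Z\<bar> \<le> (1 + dist Z' Z / \<delta>) * w"
      by (rule bounded_increment_linear[OF S \<delta>]) (use F that in auto)
    also have "\<dots> \<le> (1 + (dist Z' P + dist Z P) / \<delta>) * w"
      using \<open>w \<ge> 0\<close> \<delta> dist_triangle2[of Z' Z P]
      by (intro mult_right_mono add_left_mono divide_right_mono) auto
    finally show ?thesis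
      by (simp add: G_def algebra_simps add_divide_distrib)
  qed
  have bdd: "bdd_above (G ` S)"
    using G[OF P] by (intro bdd_aboveI2)
  fix Z assume "Z \<in> S"
  have "G Z \<le> (SUP Z\<in>S. G Z)"
    using bdd \<open>Z \<in> S\<close> by (rule cSUP_upper2) auto
  moreover have "(SUP Z\<in>S. G Z) \<le> F Z + dist Z P / \<delta> * w + w"
    using G[OF \<open>Z \<in> S\<close>] P by (intro cSUP_least) auto
  ultimately show "\<bar>F Z - c\<bar> \<le> (1 / 2 + dist Z P / \<delta>) * w"
    by (simp add: c_def G_def abs_le_iff algebra_simps)
qed

section \<open>Moduli of continuity on compact sets\<close>

text \<open>Compactness makes \<open>\<psi>\<close> bounded, so the set of increments is bounded
  above and its \<open>Sup\<close> dominates each member.\<close>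

lemma modulus_bound:
  assumes S: "compact S" and \<psi>: "continuous_on S \<psi>"
    and MP: "M \<in> S" "P \<in> S" "dist M P \<le> t"
  shows "\<bar>\<psi> M - \<psi> P\<bar> \<le> modulus S \<psi> t"
  unfolding modulus_def
proof (rule cSup_upper)
  show "\<bar>\<psi> M - \<psi> P\<bar> \<in> {\<bar>\<psi> M - \<psi> P\<bar> |M P. M \<in> S \<and> P \<in> S \<and> dist M P \<le> t}"
    using MP by blast
  have "bounded (\<psi> ` S)"
    using S \<psi> compact_continuous_image compact_imp_bounded by blast
  then obtain B where B: "\<And>M. M \<in> S \<Longrightarrow> \<bar>\<psi> M\<bar> \<le> B"
    by (auto simp: bounded_iff)
  have "\<bar>\<psi> M - \<psi> P\<bar> \<le> B + B" if "M \<in> S" "P \<in> S" for M P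
    using B[OF that(1)] B[OF that(2)] by linarith
  then show "bdd_above {\<bar>\<psi> M - \<psi> P\<bar> |M P. M \<in> S \<and> P \<in> S \<and> dist M P \<le> t}"
    by (intro bdd_aboveI[of _ "B + B"]) auto
qed

lemma modulus_deriv_one:
  "modulus_deriv S 1 f t = max (modulus S (partial_x S f) t) (modulus S (partial_y S f) t)"
proof -
  have "{\<alpha>::nat \<times> nat. fst \<alpha> + snd \<alpha> = 1} = {(1, 0), (0, 1)}"
    by auto
  then show ?thesis
    by (simp add: modulus_deriv_def partial_deriv_def)
qed

section \<open>Linear approximation with a quadratic error bound\<close>

text \<open>Cauchy-Schwarz gives the factor \<open>sqrt 2\<close>. The rational 3/2 is larger and
  leads to the coefficient 2 in \<open>C1_linear_approximation\<close>.\<close>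

lemma sum_abs_mult_sqrt_le:
  fixes s t :: real
  shows "(\<bar>s\<bar> + \<bar>t\<bar>) * sqrt (s\<^sup>2 + t\<^sup>2) \<le> 3 / 2 * (s\<^sup>2 + t\<^sup>2)"
proof -
  have "(\<bar>s\<bar> + \<bar>t\<bar>)\<^sup>2 \<le> (3 / 2 * sqrt (s\<^sup>2 + t\<^sup>2))\<^sup>2"
    using sum_squares_bound[of "\<bar>s\<bar>" "\<bar>t\<bar>"]
    by (simp add: power2_sum power_mult_distrib power_divide mult.assoc)
       (use zero_le_power2[of s] zero_le_power2[of t] in linarith)
  then have "\<bar>s\<bar> + \<bar>t\<bar> \<le> 3 / 2 * sqrt (s\<^sup>2 + t\<^sup>2)"
    by (rule power2_le_imp_le) simp
  then have "(\<bar>s\<bar> + \<bar>t\<bar>) * sqrt (s\<^sup>2 + t\<^sup>2) \<le> 3 / 2 * sqrt (s\<^sup>2 + t\<^sup>2) * sqrt (s\<^sup>2 + t\<^sup>2)"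
    by (rule mult_right_mono) simp
  then show ?thesis by (simp add: mult.assoc)
qed

text \<open>Along the segment from \<open>P\<close> to \<open>M\<close> the derivative of the error
  is at most \<open>B'\<close>, which has the primitive \<open>B\<close>. The bound is brought to
  squared distances because their averages over the B-splines can be computed.\<close>

lemma C1_linear_approximation:
  fixes X Y :: "real set" and M P :: "real \<times> real"
  assumes f: "C1_on (X \<times> Y) f" and X: "convex X" and Y: "convex Y" and h: "h > 0" and w: "w \<ge> 0"
    and MP: "M \<in> X \<times> Y" "P \<in> X \<times> Y"
    and cx: "\<And>Z. Z \<in> X \<times> Y \<Longrightarrow> \<bar>partial_x (X \<times> Y) f Z - cx\<bar> \<le> (1 / 2 + dist Z P / (h / 2)) * w"
    and cy: "\<And>Z. Z \<in> X \<times> Y \<Longrightarrow> \<bar>partial_y (X \<times> Y) f Z - cy\<bar> \<le> (1 / 2 + dist Z P / (h / 2)) * w"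
  shows "\<bar>f M - f P - (cx * (fst M - fst P) + cy * (snd M - snd P))\<bar>
           \<le> w * (2 * ((fst M - fst P)\<^sup>2 + (snd M - snd P)\<^sup>2) / h + h / 4)"
proof -
  define s where "s = fst M - fst P"
  define t where "t = snd M - snd P"
  define D where "D = sqrt (s\<^sup>2 + t\<^sup>2)"
  define A where "A = \<bar>s\<bar> + \<bar>t\<bar>"
  define p where "p r = P + r *\<^sub>R (M - P)" for r
  define B where "B r = w * A * (r / 2 + r\<^sup>2 * D / h)" for r
  define B' where "B' r = w * A * (1 / 2 + 2 * r * D / h)" for r
  define L where "L r = partial_x (X \<times> Y) f (p r) * s + partial_y (X \<times> Y) f (p r) * t" for r
  have dM: "dist M P = D"
    by (cases M; cases P) (simp add: dist_Pair_Pair D_def s_def t_def dist_real_def)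
  have p_in: "p r \<in> X \<times> Y" if "r \<in> {0..1}" for r
  proof -
    have "p r = (1 - r) *\<^sub>R P + r *\<^sub>R M"
      by (simp add: p_def algebra_simps)
    then show ?thesis
      using convexD_alt[OF convex_Times[OF X Y] MP(2,1)] that by simp
  qed
  have der: "((\<lambda>r. f (p r)) has_derivative (\<lambda>k. k * L r)) (at r within {0..1})"
    if "r \<in> {0..1}" for r
  proof -
    have p_der: "(p has_derivative (\<lambda>k. k *\<^sub>R (M - P))) (at r within {0..1})"
      unfolding p_def by (auto intro!: derivative_eq_intros)
    have "(f has_derivative (\<lambda>(s, t). s * partial_x (X \<times> Y) f (p r) + t * partial_y (X \<times> Y) f (p r)))
            (at (p r) within X \<times> Y)"
      using C1_on_has_derivative[OF f Y, of "fst (p r)" "snd (p r)"] p_in[OF that]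
      by (auto simp: mem_Times_iff)
    then have "(f has_derivative (\<lambda>(s, t). s * partial_x (X \<times> Y) f (p r) + t * partial_y (X \<times> Y) f (p r)))
            (at (p r) within p ` {0..1})"
      by (rule has_derivative_subset) (use p_in in blast)
    from has_derivative_in_compose[OF p_der this] show ?thesis
      by (simp add: L_def s_def t_def case_prod_unfold algebra_simps)
  qed
  have derB: "(B has_derivative (\<lambda>k. k * B' r)) (at r within {0..1})" for r
    unfolding B_def B'_def using h
    by (auto intro!: derivative_eq_intros simp: power2_eq_square field_simps)
  have bound: "\<bar>L r - (cx * s + cy * t)\<bar> \<le> B' r" if "r \<in> {0..1}" for r
  proof -
    have "dist (p r) P = r * D"
      using that dM by (simp add: p_def dist_norm)
    then have x: "\<bar>partial_x (X \<times> Y) f (p r) - cx\<bar> \<le> (1 / 2 + 2 * r * D / h) * w"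
      and y: "\<bar>partial_y (X \<times> Y) f (p r) - cy\<bar> \<le> (1 / 2 + 2 * r * D / h) * w"
      using cx[OF p_in[OF that]] cy[OF p_in[OF that]] by (simp_all add: mult_ac)
    have "L r - (cx * s + cy * t)
            = (partial_x (X \<times> Y) f (p r) - cx) * s + (partial_y (X \<times> Y) f (p r) - cy) * t"
      by (simp add: L_def algebra_simps)
    also have "\<bar>\<dots>\<bar> \<le> \<bar>partial_x (X \<times> Y) f (p r) - cx\<bar> * \<bar>s\<bar> + \<bar>partial_y (X \<times> Y) f (p r) - cy\<bar> * \<bar>t\<bar>"
      by (metis abs_mult abs_triangle_ineq)
    also have "\<dots> \<le> (1 / 2 + 2 * r * D / h) * w * \<bar>s\<bar> + (1 / 2 + 2 * r * D / h) * w * \<bar>t\<bar>"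
      by (intro add_mono mult_right_mono x y) auto
    also have "\<dots> = B' r"
      by (simp only: B'_def A_def) algebra
    finally show ?thesis .
  qed
  have p01: "p 0 = P" "p 1 = M"
    by (simp_all add: p_def)
  \<comment> \<open>The mean value theorem for the error minus \<open>B\<close> gives the upper
    bound, and later for the error plus \<open>B\<close> the lower one. This takes the place of
    integrating \<open>B'\<close>.\<close>
  have "((\<lambda>r. f (p r) - r * (cx * s + cy * t) - B r) has_derivative
          (\<lambda>k. k * (L r - (cx * s + cy * t) - B' r))) (at r within {0..1})" if "0 \<le> r" "r \<le> 1" for r
    using der[of r] derB[of r] that
    by (auto intro!: derivative_eq_intros simp: algebra_simps)
  from mvt_very_simple[OF zero_le_one this] obtain r where "r \<in> {0..1}"
    "f M - (cx * s + cy * t) - B 1 - (f P - B 0) = L r - (cx * s + cy * t) - B' r"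
    by (auto simp: p01)
  then have up: "f M - f P - (cx * s + cy * t) \<le> B 1"
    using bound[of r] by (simp add: B_def)
  have "((\<lambda>r. f (p r) - r * (cx * s + cy * t) + B r) has_derivative
          (\<lambda>k. k * (L r - (cx * s + cy * t) + B' r))) (at r within {0..1})" if "0 \<le> r" "r \<le> 1" for r
    using der[of r] derB[of r] that
    by (auto intro!: derivative_eq_intros simp: algebra_simps)
  from mvt_very_simple[OF zero_le_one this] obtain r where "r \<in> {0..1}"
    "f M - (cx * s + cy * t) + B 1 - (f P + B 0) = L r - (cx * s + cy * t) + B' r"
    by (auto simp: p01)
  then have lo: "- B 1 \<le> f M - f P - (cx * s + cy * t)"
    using bound[of r] by (simp add: B_def)
  \<comment> \<open>Completing the square trades the first-order term \<open>A / 2\<close> of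
    \<open>B 1\<close> for squares and a constant; the squares then have the total coefficient
    \<open>1 / 2 + 3 / 2 = 2\<close>.\<close>
  have abs_le: "\<bar>z\<bar> \<le> z\<^sup>2 / h + h / 4" for z :: real
  proof -
    have "0 \<le> (\<bar>z\<bar> - h / 2)\<^sup>2 / h"
      using h by simp
    also have "\<dots> = z\<^sup>2 / h + h / 4 - \<bar>z\<bar>"
      using h by (simp add: field_simps power2_eq_square)
    finally show ?thesis by simp
  qed
  have "B 1 = w * (A / 2 + A * D / h)"
    by (simp add: B_def algebra_simps)
  also have "\<dots> \<le> w * ((s\<^sup>2 / h + h / 4 + (t\<^sup>2 / h + h / 4)) / 2 + 3 / 2 * (s\<^sup>2 + t\<^sup>2) / h)"
    using sum_abs_mult_sqrt_le[of s t] abs_le[of s] abs_le[of t] h w unfolding A_def D_def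
    by (intro mult_left_mono add_mono divide_right_mono) auto
  also have "\<dots> = w * (2 * (s\<^sup>2 + t\<^sup>2) / h + h / 4)"
    by (simp add: add_divide_distrib algebra_simps)
  finally show ?thesis
    using up lo by (simp add: s_def t_def abs_le_iff)
qed


section \<open>Quadratic splines on a criss-cross cell\<close>

text \<open>The middle Bernstein coefficient on the segment from \<open>U\<close> to \<open>V\<close> of a function that is
  quadratic there.\<close>

definition bb_mid :: "('a::real_vector \<Rightarrow> real) \<Rightarrow> 'a \<Rightarrow> 'a \<Rightarrow> real" where
  "bb_mid g U V = 2 * g ((1 / 2) *\<^sub>R (U + V)) - (g U + g V) / 2"

text \<open>The Bernstein form on a segment, kept in a general vector space so that it serves both
  for edges in the plane and for restrictions to a grid line.\<close>

definition quadratic_on_segment :: "('a::real_vector \<Rightarrow> real) \<Rightarrow> 'a \<Rightarrow> 'a \<Rightarrow> bool" where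
  "quadratic_on_segment g U V \<longleftrightarrow>
     (\<forall>t\<in>{0..1}. g (U + t *\<^sub>R (V - U))
        = (1 - t)\<^sup>2 * g U + 2 * t * (1 - t) * bb_mid g U V + t\<^sup>2 * g V)"

lemma bb_mid_commute: "bb_mid g U V = bb_mid g V U"
  by (simp add: bb_mid_def add.commute)

lemma quadratic_on_segment_commute:
  assumes "quadratic_on_segment g U V"
  shows "quadratic_on_segment g V U"
  unfolding quadratic_on_segment_def
proof
  fix t :: real assume "t \<in> {0..1}"
  then have "g (U + (1 - t) *\<^sub>R (V - U))
      = t\<^sup>2 * g U + 2 * (1 - t) * t * bb_mid g U V + (1 - t)\<^sup>2 * g V"
    using bspec[OF assms[unfolded quadratic_on_segment_def], of "1 - t"] by simp
  moreover have "U + (1 - t) *\<^sub>R (V - U) = V + t *\<^sub>R (U - V)"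
    by (simp add: algebra_simps)
  ultimately show "g (V + t *\<^sub>R (U - V))
      = (1 - t)\<^sup>2 * g V + 2 * t * (1 - t) * bb_mid g V U + t\<^sup>2 * g U"
    by (simp add: bb_mid_commute[of g V])
qed

section \<open>Derivatives and Bernstein coefficients\<close>

text \<open>At \<open>t = 0\<close> the Bernstein form has slope twice the difference of its first
  two coefficients. Differentiability at a vertex thereby becomes linear relations between the
  coefficients of the edges meeting there.\<close>

lemma has_derivative_quadratic_on_segment:
  fixes g :: "'a::real_normed_vector \<Rightarrow> real"
  assumes D: "(g has_derivative D) (at V)" and q: "quadratic_on_segment g V W"
  shows "D (W - V) = 2 * (bb_mid g V W - g V)"
proof -
  define p where "p t = V + t *\<^sub>R (W - V)" for t :: real
  have "(p has_derivative (\<lambda>k. k *\<^sub>R (W - V))) (at 0 within {0..1})"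
    unfolding p_def by (auto intro!: derivative_eq_intros)
  moreover have "(g has_derivative D) (at (p 0) within p ` {0..1})"
    using D by (simp add: p_def has_derivative_at_withinI)
  ultimately have "((\<lambda>t. g (p t)) has_derivative (\<lambda>k. D (k *\<^sub>R (W - V)))) (at 0 within {0..1})"
    by (rule has_derivative_in_compose)
  then have "((\<lambda>t. g (p t)) has_vector_derivative D (W - V)) (at 0 within {0..1})"
    using has_derivative_bounded_linear[OF D]
    by (simp add: has_vector_derivative_def linear_simps)
  moreover have "((\<lambda>t. (1 - t)\<^sup>2 * g V + 2 * t * (1 - t) * bb_mid g V W + t\<^sup>2 * g W)
      has_vector_derivative 2 * (bb_mid g V W - g V)) (at 0 within {0..1})"
    unfolding has_vector_derivative_def
    by (auto intro!: derivative_eq_intros simp: algebra_simps)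
  then have "((\<lambda>t. g (p t)) has_vector_derivative 2 * (bb_mid g V W - g V)) (at 0 within {0..1})"
    by (rule has_vector_derivative_transform[rotated 2])
       (use q in \<open>auto simp: quadratic_on_segment_def p_def\<close>)
  ultimately show ?thesis
    using vector_derivative_unique_within_closed_interval[of 0 1 0] by auto
qed

section \<open>Quadratic polynomials on triangles\<close>

text \<open>For a polynomial of degree at most 2, \<open>bb_mid\<close> is the symmetric bi-affine
  polar form; evaluating it twice at the same barycentric combination and expanding gives the
  Bernstein form.\<close>

lemma poly_quadratic_triangle:
  assumes g: "poly_deg_le_on 2 T g" and T: "convex T" "U \<in> T" "V \<in> T" "W \<in> T"
    and abc: "a \<ge> 0" "b \<ge> 0" "c \<ge> 0" "a + b + c = 1"
  shows "g (a *\<^sub>R U + b *\<^sub>R V + c *\<^sub>R W)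
    = a\<^sup>2 * g U + b\<^sup>2 * g V + c\<^sup>2 * g W
      + 2 * a * b * bb_mid g U V + 2 * a * c * bb_mid g U W + 2 * b * c * bb_mid g V W"
proof -
  obtain d where d: "\<forall>(x, y)\<in>T. g (x, y) = (\<Sum>k\<le>2. \<Sum>l\<le>2 - k. d k l * x ^ k * y ^ l)"
    using g by (auto simp: poly_deg_le_on_def)
  have d: "g (x, y) = d 0 0 + d 0 1 * y + d 0 2 * y\<^sup>2 + d 1 0 * x + d 1 1 * x * y + d 2 0 * x\<^sup>2"
    if "(x, y) \<in> T" for x y
    using bspec[OF d that] by (simp add: numeral_2_eq_2)
  have mem: "\<alpha> *\<^sub>R M + \<beta> *\<^sub>R N \<in> T" if "M \<in> T" "N \<in> T" "\<alpha> \<ge> 0" "\<beta> \<ge> 0" "\<alpha> + \<beta> = 1" for M N \<alpha> \<beta>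
    using that T(1) by (auto simp: convex_def)
  obtain U1 U2 V1 V2 W1 W2 where UVW: "U = (U1, U2)" "V = (V1, V2)" "W = (W1, W2)"
    by (cases U; cases V; cases W)
  have "a *\<^sub>R U + b *\<^sub>R V + c *\<^sub>R W \<in> convex hull {U, V, W}"
    using abc by (auto simp: convex_hull_3)
  then have "a *\<^sub>R U + b *\<^sub>R V + c *\<^sub>R W \<in> T"
    using T hull_minimal[of "{U, V, W}" T convex] by auto
  then have g0: "g (a *\<^sub>R U + b *\<^sub>R V + c *\<^sub>R W) =
      d 0 0 + d 0 1 * (a * U2 + b * V2 + c * W2) + d 0 2 * (a * U2 + b * V2 + c * W2)\<^sup>2
      + d 1 0 * (a * U1 + b * V1 + c * W1) + d 1 1 * (a * U1 + b * V1 + c * W1) * (a * U2 + b * V2 + c * W2)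
      + d 2 0 * (a * U1 + b * V1 + c * W1)\<^sup>2"
    using d by (simp add: UVW)
  \<comment> \<open>The polar form in monomials: linear terms are averaged over the two points, and
    quadratic ones become symmetrized products.\<close>
  have mid: "bb_mid g (M1, M2) (N1, N2) = d 0 0 + d 0 1 * (M2 + N2) / 2 + d 0 2 * M2 * N2
      + d 1 0 * (M1 + N1) / 2 + d 1 1 * (M1 * N2 + M2 * N1) / 2 + d 2 0 * M1 * N1"
    if "(M1, M2) \<in> T" "(N1, N2) \<in> T" for M1 M2 N1 N2
  proof -
    have "((M1 + N1) / 2, (M2 + N2) / 2) \<in> T"
      using mem[OF that, of "1/2" "1/2"] by (simp add: add_divide_distrib)
    from d[OF this] d[OF that(1)] d[OF that(2)] show ?thesis
      by (simp add: bb_mid_def field_simps power2_eq_square)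
  qed
  have a: "a = 1 - b - c"
    using abc by simp
  have UVW_mem: "(U1, U2) \<in> T" "(V1, V2) \<in> T" "(W1, W2) \<in> T"
    using T UVW by auto
  show ?thesis
    unfolding g0 unfolding UVW mid[OF UVW_mem(1,2)] mid[OF UVW_mem(1,3)] mid[OF UVW_mem(2,3)]
      d[OF UVW_mem(1)] d[OF UVW_mem(2)] d[OF UVW_mem(3)] a
    by (simp add: field_simps power2_eq_square)
qed

lemma poly_quadratic_on_segment:
  assumes "poly_deg_le_on 2 T g" "convex T" "U \<in> T" "V \<in> T"
  shows "quadratic_on_segment g U V"
  unfolding quadratic_on_segment_def
proof
  fix t :: real assume "t \<in> {0..1}"
  then show "g (U + t *\<^sub>R (V - U)) = (1 - t)\<^sup>2 * g U + 2 * t * (1 - t) * bb_mid g U V + t\<^sup>2 * g V"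
    using poly_quadratic_triangle[OF assms assms(4), of "1 - t" t 0]
    by (simp add: algebra_simps)
qed

section \<open>Smoothness conditions at corners and centre\<close>

text \<open>The derivative at \<open>V\<close> is linear, so the slope towards the midpoint of
  \<open>A\<close> and \<open>B\<close> is the mean of the slopes towards \<open>A\<close> and
  \<open>B\<close>. When \<open>A\<close> and \<open>B\<close> are the neighbours of a corner
  \<open>V\<close> of a cell, that midpoint is the centre.\<close>

lemma C1_corner:
  fixes g :: "'a::real_normed_vector \<Rightarrow> real"
  assumes "g differentiable (at V)" and q: "quadratic_on_segment g V A" "quadratic_on_segment g V B"
    "quadratic_on_segment g V ((1 / 2) *\<^sub>R (A + B))"
  shows "bb_mid g V ((1 / 2) *\<^sub>R (A + B)) = (bb_mid g V A + bb_mid g V B) / 2"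
proof -
  obtain D where D: "(g has_derivative D) (at V)"
    using assms(1) by (auto simp: differentiable_def)
  have eq: "(1 / 2) *\<^sub>R (A + B) - V = (1 / 2) *\<^sub>R ((A - V) + (B - V))"
    by (simp add: algebra_simps flip: scaleR_add_left)
  have "D ((1 / 2) *\<^sub>R (A + B) - V) = (D (A - V) + D (B - V)) / 2"
    unfolding eq using has_derivative_bounded_linear[OF D] by (simp only: linear_simps) simp
  then show ?thesis
    unfolding has_derivative_quadratic_on_segment[OF D q(1)]
      has_derivative_quadratic_on_segment[OF D q(2)] has_derivative_quadratic_on_segment[OF D q(3)]
    by (simp add: field_simps)
qed

text \<open>The two halves of a diagonal leave \<open>z\<close> in opposite directions, so their
  slopes at \<open>z\<close> cancel.\<close>

lemma C1_centre:
  fixes g :: "'a::real_normed_vector \<Rightarrow> real"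
  assumes "g differentiable (at z)" and q: "quadratic_on_segment g z A" "quadratic_on_segment g z B"
    and z: "z = (1 / 2) *\<^sub>R (A + B)"
  shows "g z = (bb_mid g z A + bb_mid g z B) / 2"
proof -
  obtain D where D: "(g has_derivative D) (at z)"
    using assms(1) by (auto simp: differentiable_def)
  have "(A - z) + (B - z) = 0"
    unfolding z by (simp add: algebra_simps flip: scaleR_add_left)
  then have "D (A - z) + D (B - z) = 0"
    using has_derivative_bounded_linear[OF D] by (metis linear_simps(1) linear_simps(3))
  then show ?thesis
    unfolding has_derivative_quadratic_on_segment[OF D q(1)]
      has_derivative_quadratic_on_segment[OF D q(2)]
    by (simp add: field_simps)
qed

text \<open>The interior Bernstein coefficients are averages of the boundary ones, by differentiability
  at the corners and at the centre.\<close>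

lemma criss_cross_expansion:
  fixes g :: "real \<times> real \<Rightarrow> real"
  assumes diff: "\<And>V. g differentiable (at V)"
    and poly: "poly_deg_le_on 2 (convex hull {z, V1, V2}) g" "poly_deg_le_on 2 (convex hull {z, V2, V3}) g"
      "poly_deg_le_on 2 (convex hull {z, V3, V4}) g" "poly_deg_le_on 2 (convex hull {z, V4, V1}) g"
    and z: "z = (1 / 2) *\<^sub>R (V1 + V3)" "z = (1 / 2) *\<^sub>R (V2 + V4)"
    and abc: "a \<ge> 0" "b \<ge> 0" "c \<ge> 0" "a + b + c = 1"
  shows "g (a *\<^sub>R z + b *\<^sub>R V1 + c *\<^sub>R V2)
    = b\<^sup>2 * g V1 + c\<^sup>2 * g V2 + (2 * b * c + a * b + a * c + a\<^sup>2 / 4) * bb_mid g V1 V2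
      + (a * c + a\<^sup>2 / 4) * bb_mid g V2 V3 + a\<^sup>2 / 4 * bb_mid g V3 V4 + (a * b + a\<^sup>2 / 4) * bb_mid g V4 V1"
proof -
  have in_hull: "P \<in> convex hull {P, Q, R}" "Q \<in> convex hull {P, Q, R}" "R \<in> convex hull {P, Q, R}"
    for P Q R :: "real \<times> real"
    by (auto intro: hull_inc)
  have seg: "quadratic_on_segment g P Q" "quadratic_on_segment g P R" "quadratic_on_segment g Q P"
    "quadratic_on_segment g Q R" "quadratic_on_segment g R P" "quadratic_on_segment g R Q"
    if "poly_deg_le_on 2 (convex hull {P, Q, R}) g" for P Q R
    by (auto intro!: poly_quadratic_on_segment[OF that] in_hull)
  have c1: "bb_mid g z V1 = (bb_mid g V1 V2 + bb_mid g V4 V1) / 2"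
    using C1_corner[OF diff, of V1 V2 V4] seg poly unfolding z(2)[symmetric]
    by (metis bb_mid_commute)
  have c2: "bb_mid g z V2 = (bb_mid g V1 V2 + bb_mid g V2 V3) / 2"
    using C1_corner[OF diff, of V2 V1 V3] seg poly unfolding z(1)[symmetric]
    by (metis bb_mid_commute)
  have c3: "bb_mid g z V3 = (bb_mid g V2 V3 + bb_mid g V3 V4) / 2"
    using C1_corner[OF diff, of V3 V2 V4] seg poly unfolding z(2)[symmetric]
    by (metis bb_mid_commute)
  \<comment> \<open>\<open>V1\<close> and \<open>V3\<close> are opposite corners, so after inserting
    \<open>c1\<close> and \<open>c3\<close> each of the four edge coefficients has weight 1/4 in the
    value at the centre.\<close>
  have c0: "g z = (bb_mid g z V1 + bb_mid g z V3) / 2"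
    using seg poly z(1) by (intro C1_centre[OF diff]) blast+
  show ?thesis
    unfolding poly_quadratic_triangle[OF poly(1) convex_convex_hull in_hull abc]
    unfolding c0 c1 c2 c3 by (simp add: field_simps power2_eq_square)
qed

text \<open>The Bernstein coefficients of \<open>g\<close> on the boundary of \<open>[x0, x1] \<times> [y0, y1]\<close> are those of a
  tensor product of quadratics with coefficients \<open>X\<close> and \<open>Y\<close>.\<close>

definition product_boundary ::
    "(real \<times> real \<Rightarrow> real) \<Rightarrow> real \<Rightarrow> real \<Rightarrow> real \<Rightarrow> real \<Rightarrow> (nat \<Rightarrow> real) \<Rightarrow> (nat \<Rightarrow> real) \<Rightarrow> bool" where
  "product_boundary g x0 x1 y0 y1 X Y \<longleftrightarrow>
     g (x0, y0) = X 0 * Y 0 \<and> g (x1, y0) = X 2 * Y 0 \<and> g (x0, y1) = X 0 * Y 2 \<and> g (x1, y1) = X 2 * Y 2 \<and>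
     bb_mid g (x0, y0) (x1, y0) = X 1 * Y 0 \<and> bb_mid g (x0, y1) (x1, y1) = X 1 * Y 2 \<and>
     bb_mid g (x0, y0) (x0, y1) = X 0 * Y 1 \<and> bb_mid g (x1, y0) (x1, y1) = X 2 * Y 1"

section \<open>Weights common to all splines on a cell\<close>

text \<open>A local form of the spline conditions, met by the classical B-splines as well as by
  global quadratics in one variable, so that both can be evaluated with the same weights.\<close>

definition cell_spline :: "real \<Rightarrow> real \<Rightarrow> real \<Rightarrow> real \<Rightarrow> (real \<times> real \<Rightarrow> real) \<Rightarrow> bool" where
  "cell_spline x0 x1 y0 y1 g \<longleftrightarrow>
     (\<forall>V. g differentiable (at V)) \<and> (\<forall>T\<in>criss_cross_cell x0 x1 y0 y1. poly_deg_le_on 2 T g)"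

lemma sum_atMost_2: "(\<Sum>a\<le>2::nat. F a) = F 0 + F 1 + (F 2 :: real)"
  by (simp add: numeral_2_eq_2)

text \<open>The weights are fixed by \<open>P\<close> and the cell before \<open>g\<close> is
  chosen, and \<open>criss_cross_expansion\<close> shows them to be sums of products of barycentric
  coordinates.\<close>

lemma criss_cross_weights:
  assumes "P \<in> \<Union> (criss_cross_cell x0 x1 y0 y1)"
  obtains w :: "nat \<Rightarrow> nat \<Rightarrow> real" where "\<And>a b. 0 \<le> w a b"
    and "\<And>g X Y. cell_spline x0 x1 y0 y1 g \<Longrightarrow> product_boundary g x0 x1 y0 y1 X Y \<Longrightarrow>
           g P = (\<Sum>a\<le>2. \<Sum>b\<le>2. w a b * (X a * Y b))"
proof -
  define z where "z = ((x0 + x1) / 2, (y0 + y1) / 2)"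
  \<comment> \<open>Eight weights for the boundary coefficients, arranged as a 3 by 3 array; the
    interior product \<open>X 1 * Y 1\<close> gets weight 0.\<close>
  define \<omega> where "\<omega> w00 w20 w22 w02 w10 w21 w12 w01 a b =
      (if a = 0 \<and> b = 0 then w00 else if a = 2 \<and> b = 0 then w20 else if a = 2 \<and> b = 2 then w22
       else if a = 0 \<and> b = 2 then w02 else if a = 1 \<and> b = 0 then w10 else if a = 2 \<and> b = 1 then w21
       else if a = 1 \<and> b = 2 then w12 else if a = 0 \<and> b = 1 then w01 else 0)"
    for w00 w20 w22 w02 w10 w21 w12 w01 :: real and a b :: nat
  \<comment> \<open>Both diagonals from each end, in cyclic order, so that the four triangles are
    rotations of one case of \<open>criss_cross_expansion\<close>.\<close>
  have z1: "z = (1 / 2) *\<^sub>R ((x0, y0) + (x1, y1))" "z = (1 / 2) *\<^sub>R ((x1, y0) + (x0, y1))"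
    "z = (1 / 2) *\<^sub>R ((x1, y1) + (x0, y0))" "z = (1 / 2) *\<^sub>R ((x0, y1) + (x1, y0))"
    by (simp_all add: z_def add.commute)
  have cell: "criss_cross_cell x0 x1 y0 y1 =
      {convex hull {z, (x0, y0), (x1, y0)}, convex hull {z, (x1, y0), (x1, y1)},
       convex hull {z, (x1, y1), (x0, y1)}, convex hull {z, (x0, y1), (x0, y0)}}"
    by (simp add: criss_cross_cell_def Let_def z_def)
  have nonneg: "0 \<le> \<omega> w00 w20 w22 w02 w10 w21 w12 w01 a b"
    if "w00 \<ge> 0" "w20 \<ge> 0" "w22 \<ge> 0" "w02 \<ge> 0" "w10 \<ge> 0" "w21 \<ge> 0" "w12 \<ge> 0" "w01 \<ge> 0"
    for w00 w20 w22 w02 w10 w21 w12 w01 a b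
    using that by (simp add: \<omega>_def)
  have expand: "(\<Sum>a\<le>2. \<Sum>b\<le>2. \<omega> w00 w20 w22 w02 w10 w21 w12 w01 a b * (X a * Y b))
      = w00 * g (x0, y0) + w20 * g (x1, y0) + w22 * g (x1, y1) + w02 * g (x0, y1)
        + w10 * bb_mid g (x0, y0) (x1, y0) + w21 * bb_mid g (x1, y0) (x1, y1)
        + w12 * bb_mid g (x1, y1) (x0, y1) + w01 * bb_mid g (x0, y1) (x0, y0)"
    if "product_boundary g x0 x1 y0 y1 X Y" for g X Y w00 w20 w22 w02 w10 w21 w12 w01
    using that bb_mid_commute[of g "(x1, y1)"] bb_mid_commute[of g "(x0, y1)" "(x0, y0)"]
    unfolding product_boundary_def sum_atMost_2 \<omega>_def by simp
  consider "P \<in> convex hull {z, (x0, y0), (x1, y0)}" | "P \<in> convex hull {z, (x1, y0), (x1, y1)}"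
    | "P \<in> convex hull {z, (x1, y1), (x0, y1)}" | "P \<in> convex hull {z, (x0, y1), (x0, y0)}"
    using assms unfolding cell by blast
  then show thesis
  proof cases
    case 1
    then obtain a b c where abc: "a \<ge> 0" "b \<ge> 0" "c \<ge> 0" "a + b + c = 1"
      and P: "P = a *\<^sub>R z + b *\<^sub>R (x0, y0) + c *\<^sub>R (x1, y0)"
      unfolding convex_hull_3 by blast
    show thesis
    proof (rule that)
      show "0 \<le> \<omega> (b\<^sup>2) (c\<^sup>2) 0 0 (2 * b * c + a * b + a * c + a\<^sup>2 / 4) (a * c + a\<^sup>2 / 4) (a\<^sup>2 / 4)
              (a * b + a\<^sup>2 / 4) i j" for i j
        using abc by (intro nonneg) auto
      fix g X Y assume g: "cell_spline x0 x1 y0 y1 g" and B: "product_boundary g x0 x1 y0 y1 X Y"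
      show "g P = (\<Sum>i\<le>2. \<Sum>j\<le>2. \<omega> (b\<^sup>2) (c\<^sup>2) 0 0 (2 * b * c + a * b + a * c + a\<^sup>2 / 4)
              (a * c + a\<^sup>2 / 4) (a\<^sup>2 / 4) (a * b + a\<^sup>2 / 4) i j * (X i * Y j))"
        unfolding expand[OF B] P using g unfolding cell_spline_def cell
        by (subst criss_cross_expansion[OF _ _ _ _ _ z1(1,2) abc]) auto
    qed
  next
    case 2
    then obtain a b c where abc: "a \<ge> 0" "b \<ge> 0" "c \<ge> 0" "a + b + c = 1"
      and P: "P = a *\<^sub>R z + b *\<^sub>R (x1, y0) + c *\<^sub>R (x1, y1)"
      unfolding convex_hull_3 by blast
    show thesis
    proof (rule that)
      show "0 \<le> \<omega> 0 (b\<^sup>2) (c\<^sup>2) 0 (a * b + a\<^sup>2 / 4) (2 * b * c + a * b + a * c + a\<^sup>2 / 4)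
              (a * c + a\<^sup>2 / 4) (a\<^sup>2 / 4) i j" for i j
        using abc by (intro nonneg) auto
      fix g X Y assume g: "cell_spline x0 x1 y0 y1 g" and B: "product_boundary g x0 x1 y0 y1 X Y"
      show "g P = (\<Sum>i\<le>2. \<Sum>j\<le>2. \<omega> 0 (b\<^sup>2) (c\<^sup>2) 0 (a * b + a\<^sup>2 / 4)
              (2 * b * c + a * b + a * c + a\<^sup>2 / 4) (a * c + a\<^sup>2 / 4) (a\<^sup>2 / 4) i j * (X i * Y j))"
        unfolding expand[OF B] P using g unfolding cell_spline_def cell
        by (subst criss_cross_expansion[OF _ _ _ _ _ z1(2,3) abc]) auto
    qed
  next
    case 3
    then obtain a b c where abc: "a \<ge> 0" "b \<ge> 0" "c \<ge> 0" "a + b + c = 1"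
      and P: "P = a *\<^sub>R z + b *\<^sub>R (x1, y1) + c *\<^sub>R (x0, y1)"
      unfolding convex_hull_3 by blast
    show thesis
    proof (rule that)
      show "0 \<le> \<omega> 0 0 (b\<^sup>2) (c\<^sup>2) (a\<^sup>2 / 4) (a * b + a\<^sup>2 / 4)
              (2 * b * c + a * b + a * c + a\<^sup>2 / 4) (a * c + a\<^sup>2 / 4) i j" for i j
        using abc by (intro nonneg) auto
      fix g X Y assume g: "cell_spline x0 x1 y0 y1 g" and B: "product_boundary g x0 x1 y0 y1 X Y"
      show "g P = (\<Sum>i\<le>2. \<Sum>j\<le>2. \<omega> 0 0 (b\<^sup>2) (c\<^sup>2) (a\<^sup>2 / 4) (a * b + a\<^sup>2 / 4)
              (2 * b * c + a * b + a * c + a\<^sup>2 / 4) (a * c + a\<^sup>2 / 4) i j * (X i * Y j))"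
        unfolding expand[OF B] P using g unfolding cell_spline_def cell
        by (subst criss_cross_expansion[OF _ _ _ _ _ z1(3,4) abc]) auto
    qed
  next
    case 4
    then obtain a b c where abc: "a \<ge> 0" "b \<ge> 0" "c \<ge> 0" "a + b + c = 1"
      and P: "P = a *\<^sub>R z + b *\<^sub>R (x0, y1) + c *\<^sub>R (x0, y0)"
      unfolding convex_hull_3 by blast
    show thesis
    proof (rule that)
      show "0 \<le> \<omega> (c\<^sup>2) 0 0 (b\<^sup>2) (a * c + a\<^sup>2 / 4) (a\<^sup>2 / 4) (a * b + a\<^sup>2 / 4)
              (2 * b * c + a * b + a * c + a\<^sup>2 / 4) i j" for i j
        using abc by (intro nonneg) auto
      fix g X Y assume g: "cell_spline x0 x1 y0 y1 g" and B: "product_boundary g x0 x1 y0 y1 X Y"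
      show "g P = (\<Sum>i\<le>2. \<Sum>j\<le>2. \<omega> (c\<^sup>2) 0 0 (b\<^sup>2) (a * c + a\<^sup>2 / 4) (a\<^sup>2 / 4)
              (a * b + a\<^sup>2 / 4) (2 * b * c + a * b + a * c + a\<^sup>2 / 4) i j * (X i * Y j))"
        unfolding expand[OF B] P using g unfolding cell_spline_def cell
        by (subst criss_cross_expansion[OF _ _ _ _ _ z1(4,1) abc]) auto
    qed
  qed
qed

section \<open>Covering a cell, and quadratics in one variable\<close>

lemma criss_cross_cell_covers:
  assumes "x0 < x1" "y0 < y1" "x \<in> {x0..x1}" "y \<in> {y0..y1}"
  shows "(x, y) \<in> \<Union> (criss_cross_cell x0 x1 y0 y1)"
proof -
  define s where "s = (x - x0) / (x1 - x0)"
  define t where "t = (y - y0) / (y1 - y0)"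
  have st: "0 \<le> s" "s \<le> 1" "0 \<le> t" "t \<le> 1"
    using assms by (simp_all add: s_def t_def)
  have xy: "x = x0 + s * (x1 - x0)" "y = y0 + t * (y1 - y0)"
    using assms by (simp_all add: s_def t_def)
  have tri: "(x, y) \<in> convex hull {U, V, W}"
    if "a \<ge> 0" "b \<ge> 0" "c \<ge> 0" "a + b + c = 1" "(x, y) = a *\<^sub>R U + b *\<^sub>R V + c *\<^sub>R W" for a b c U V W
    unfolding convex_hull_3 using that by blast
  \<comment> \<open>In normalized coordinates the diagonals are \<open>t = s\<close> and
    \<open>t = 1 - s\<close>. In each triangle the barycentric coordinate of the centre is twice the
    distance to the outer edge.\<close>
  consider "t \<le> s" "t \<le> 1 - s" | "t \<le> s" "1 - s \<le> t" | "s \<le> t" "1 - s \<le> t" | "s \<le> t" "t \<le> 1 - s"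
    by linarith
  then show ?thesis
  proof cases
    case 1
    then have "(x, y) \<in> convex hull {((x0 + x1) / 2, (y0 + y1) / 2), (x0, y0), (x1, y0)}"
      using st by (intro tri[of "2 * t" "1 - s - t" "s - t"]) (auto simp: xy field_simps)
    then show ?thesis by (simp add: criss_cross_cell_def Let_def)
  next
    case 2
    then have "(x, y) \<in> convex hull {((x0 + x1) / 2, (y0 + y1) / 2), (x1, y0), (x1, y1)}"
      using st by (intro tri[of "2 * (1 - s)" "s - t" "s + t - 1"]) (auto simp: xy field_simps)
    then show ?thesis by (simp add: criss_cross_cell_def Let_def)
  next
    case 3
    then have "(x, y) \<in> convex hull {((x0 + x1) / 2, (y0 + y1) / 2), (x1, y1), (x0, y1)}"
      using st by (intro tri[of "2 * (1 - t)" "s + t - 1" "t - s"]) (auto simp: xy field_simps)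
    then show ?thesis by (simp add: criss_cross_cell_def Let_def)
  next
    case 4
    then have "(x, y) \<in> convex hull {((x0 + x1) / 2, (y0 + y1) / 2), (x0, y1), (x0, y0)}"
      using st by (intro tri[of "2 * s" "t - s" "1 - s - t"]) (auto simp: xy field_simps)
    then show ?thesis by (simp add: criss_cross_cell_def Let_def)
  qed
qed

lemma poly_deg_le_on_quadratic_x: "poly_deg_le_on 2 T (\<lambda>P. c0 + c1 * fst P + c2 * (fst P)\<^sup>2)"
  unfolding poly_deg_le_on_def
  by (rule exI[of _ "\<lambda>k l. if l = 0 then (if k = 0 then c0 else if k = 1 then c1 else c2) else 0"])
     (simp add: numeral_2_eq_2)

lemma poly_deg_le_on_quadratic_y: "poly_deg_le_on 2 T (\<lambda>P. c0 + c1 * snd P + c2 * (snd P)\<^sup>2)"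
  unfolding poly_deg_le_on_def
  by (rule exI[of _ "\<lambda>k l. if k = 0 then (if l = 0 then c0 else if l = 1 then c1 else c2) else 0"])
     (simp add: numeral_2_eq_2)

text \<open>A quadratic in one coordinate is itself a spline on the cell, with constant 1 as its
  factor in the other direction. The lists hold the Bernstein coefficients of the first and second
  powers of that coordinate.\<close>

lemma quadratic_weights:
  fixes w :: "nat \<Rightarrow> nat \<Rightarrow> real"
  assumes w: "\<And>g X Y. cell_spline x0 x1 y0 y1 g \<Longrightarrow> product_boundary g x0 x1 y0 y1 X Y \<Longrightarrow>
           g P = (\<Sum>a\<le>2. \<Sum>b\<le>2. w a b * (X a * Y b))"
  shows "(\<Sum>a\<le>2. \<Sum>b\<le>2. w a b * (c0 + c1 * ([x0, (x0 + x1) / 2, x1] ! a) + c2 * ([x0\<^sup>2, x0 * x1, x1\<^sup>2] ! a)))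
           = c0 + c1 * fst P + c2 * (fst P)\<^sup>2" (is ?x)
    and "(\<Sum>a\<le>2. \<Sum>b\<le>2. w a b * (c0 + c1 * ([y0, (y0 + y1) / 2, y1] ! b) + c2 * ([y0\<^sup>2, y0 * y1, y1\<^sup>2] ! b)))
           = c0 + c1 * snd P + c2 * (snd P)\<^sup>2" (is ?y)
proof -
  have sq: "(\<lambda>P. c0 + c1 * f P + c2 * (f P)\<^sup>2) differentiable (at V)"
    if "bounded_linear f" for f :: "real \<times> real \<Rightarrow> real" and V
    by (intro derivative_intros bounded_linear_imp_differentiable that)
  have cx: "cell_spline x0 x1 y0 y1 (\<lambda>P. c0 + c1 * fst P + c2 * (fst P)\<^sup>2)"
    using sq[OF bounded_linear_fst] poly_deg_le_on_quadratic_x by (simp add: cell_spline_def)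
  have pbx: "product_boundary (\<lambda>P. c0 + c1 * fst P + c2 * (fst P)\<^sup>2) x0 x1 y0 y1
      (\<lambda>a. c0 + c1 * ([x0, (x0 + x1) / 2, x1] ! a) + c2 * ([x0\<^sup>2, x0 * x1, x1\<^sup>2] ! a)) (\<lambda>_. 1)"
    by (simp add: product_boundary_def bb_mid_def field_simps power2_eq_square)
  from w[OF cx pbx] show ?x
    by (simp only: mult_1_right)
  have cy: "cell_spline x0 x1 y0 y1 (\<lambda>P. c0 + c1 * snd P + c2 * (snd P)\<^sup>2)"
    using sq[OF bounded_linear_snd] poly_deg_le_on_quadratic_y by (simp add: cell_spline_def)
  have pby: "product_boundary (\<lambda>P. c0 + c1 * snd P + c2 * (snd P)\<^sup>2) x0 x1 y0 y1 (\<lambda>_. 1)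
      (\<lambda>b. c0 + c1 * ([y0, (y0 + y1) / 2, y1] ! b) + c2 * ([y0\<^sup>2, y0 * y1, y1\<^sup>2] ! b))"
    by (simp add: product_boundary_def bb_mid_def field_simps power2_eq_square)
  from w[OF cy pby] show ?y
    by (simp only: mult_1_left)
qed


section \<open>B-splines\<close>

text \<open>The value at the knot \<open>u p\<close> of the univariate quadratic B-spline with knots
  \<open>u (i - 2), \<dots>, u (i + 1)\<close>.\<close>

definition knot_value :: "(int \<Rightarrow> real) \<Rightarrow> int \<Rightarrow> int \<Rightarrow> real" where
  "knot_value u i p =
     (if p = i then (u (i + 1) - u i) / (u (i + 1) - u (i - 1))
      else if p = i - 1 then (u (i - 1) - u (i - 2)) / (u i - u (i - 2)) else 0)"

section \<open>Univariate quadratic splines of minimal support\<close>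

text \<open>Such a spline has one degree of freedom, its middle coefficient on the middle interval:
  value and slope vanish at the outer knots, and equality of the one-sided slopes at the two inner
  knots determines the values there.\<close>

lemma quadratic_spline_on_three_intervals:
  fixes \<phi> :: "real \<Rightarrow> real" and u :: "int \<Rightarrow> real"
  assumes u: "strict_mono_on {-2..m+2} u" and i: "i \<in> {0..m+1}"
    and diff: "\<And>t. \<phi> differentiable (at t)"
    and quad: "\<And>k. k \<in> {-1..m+2} \<Longrightarrow> quadratic_on_segment \<phi> (u (k - 1)) (u k)"
    and supp: "\<And>t. t < u (i - 2) \<or> u (i + 1) < t \<Longrightarrow> \<phi> t = 0"
  shows "p \<in> {-1..m+1} \<Longrightarrow> \<phi> (u p) = bb_mid \<phi> (u (i - 1)) (u i) * knot_value u i p" (is "_ \<Longrightarrow> ?p")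
    and "k \<in> {1..m} \<Longrightarrow> bb_mid \<phi> (u (k - 1)) (u k) = (if k = i then bb_mid \<phi> (u (i - 1)) (u i) else 0)"
      (is "_ \<Longrightarrow> ?k")
proof -
  have less: "u p < u q" if "p < q" "-2 \<le> p" "q \<le> m + 2" for p q
    using u that by (auto simp: strict_mono_on_def)
  have le: "u p \<le> u q" if "p \<le> q" "-2 \<le> p" "q \<le> m + 2" for p q
    using less[of p q] that by (cases "p = q") auto
  \<comment> \<open>The support hypothesis covers only points strictly outside; continuity extends
    it to the end knots.\<close>
  have "continuous_on UNIV \<phi>"
    using diff differentiable_imp_continuous_within by (auto simp: continuous_on_eq_continuous_within)
  then have "closed {t. \<phi> t = 0}"
    using continuous_closed_vimage[of "{0}" \<phi>] by (simp add: continuous_on_eq_continuous_at vimage_def)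
  then have "closure {..<u (i - 2)} \<subseteq> {t. \<phi> t = 0}" "closure {u (i + 1)<..} \<subseteq> {t. \<phi> t = 0}"
    using supp by - (rule closure_minimal, blast, assumption)+
  then have supp: "\<phi> t = 0" if "t \<le> u (i - 2) \<or> u (i + 1) \<le> t" for t
    using that by (auto simp: closure_lessThan closure_greaterThan)
  let ?a = "u (i - 2)" and ?b = "u (i - 1)" and ?c = "u i" and ?d = "u (i + 1)"
  define e where "e = bb_mid \<phi> ?b ?c"
  have abcd: "?a < ?b" "?b < ?c" "?c < ?d"
    using i by (auto intro!: less)
  \<comment> \<open>The derivative at \<open>V\<close> is one number, which relates the Bernstein
    coefficients on all segments issuing from \<open>V\<close>, to either side.\<close>
  have D: "\<exists>D. \<forall>W. quadratic_on_segment \<phi> V W \<longrightarrow> (W - V) * D = 2 * (bb_mid \<phi> V W - \<phi> V)" for V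
  proof -
    obtain D where D: "(\<phi> has_derivative D) (at V)"
      using diff[of V] by (auto simp: differentiable_def)
    then obtain d where "D = (\<lambda>x. x * d)"
      using has_derivative_bounded_linear real_bounded_linear by blast
    with has_derivative_quadratic_on_segment[OF D] show ?thesis
      by metis
  qed
  have q: "quadratic_on_segment \<phi> ?a ?b" "quadratic_on_segment \<phi> ?b ?c" "quadratic_on_segment \<phi> ?c ?d"
    using quad[of "i - 1"] quad[of i] quad[of "i + 1"] i by auto
  note q' = q[THEN quadratic_on_segment_commute]
  have ab: "bb_mid \<phi> ?a ?b = 0"
  proof -
    \<comment> \<open>The segment to \<open>?a - 1\<close> lies outside the support and forces slope
      0 at \<open>?a\<close>.\<close>
    have "quadratic_on_segment \<phi> ?a (?a - 1)" "bb_mid \<phi> ?a (?a - 1) = 0" "\<phi> ?a = 0"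
      using supp by (auto simp: quadratic_on_segment_def bb_mid_def)
    moreover obtain d where d: "\<forall>W. quadratic_on_segment \<phi> ?a W \<longrightarrow>
        (W - ?a) * d = 2 * (bb_mid \<phi> ?a W - \<phi> ?a)"
      using D by blast
    ultimately have "d = 0" by fastforce
    with d q(1) \<open>\<phi> ?a = 0\<close> show ?thesis by auto
  qed
  have cd: "bb_mid \<phi> ?c ?d = 0"
  proof -
    have "quadratic_on_segment \<phi> ?d (?d + 1)" "bb_mid \<phi> ?d (?d + 1) = 0" "\<phi> ?d = 0"
      using supp by (auto simp: quadratic_on_segment_def bb_mid_def)
    moreover obtain d where d: "\<forall>W. quadratic_on_segment \<phi> ?d W \<longrightarrow>
        (W - ?d) * d = 2 * (bb_mid \<phi> ?d W - \<phi> ?d)"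
      using D by blast
    ultimately have "d = 0" by fastforce
    with d q'(3) \<open>\<phi> ?d = 0\<close> show ?thesis by (auto simp: bb_mid_commute[of \<phi> ?c])
  qed
  have b: "\<phi> ?b = e * ((?b - ?a) / (?c - ?a))"
  proof -
    \<comment> \<open>The same slope \<open>d\<close> occurs on both sides of \<open>?b\<close>;
      eliminating it expresses \<open>\<phi> ?b\<close> through \<open>e\<close>.\<close>
    obtain d where "(?a - ?b) * d = 2 * (0 - \<phi> ?b)" "(?c - ?b) * d = 2 * (e - \<phi> ?b)"
      using D[of ?b] q'(1) q(2) ab unfolding e_def by (metis bb_mid_commute)
    then have "2 * (0 - \<phi> ?b) * (?c - ?b) = 2 * (e - \<phi> ?b) * (?a - ?b)"
      by algebra
    then show ?thesis
      using abcd by (simp add: field_simps)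
  qed
  have c: "\<phi> ?c = e * ((?d - ?c) / (?d - ?b))"
  proof -
    obtain d where "(?d - ?c) * d = 2 * (0 - \<phi> ?c)" "(?b - ?c) * d = 2 * (e - \<phi> ?c)"
      using D[of ?c] q'(2) q(3) cd unfolding e_def by (metis bb_mid_commute)
    then have "2 * (0 - \<phi> ?c) * (?b - ?c) = 2 * (e - \<phi> ?c) * (?d - ?c)"
      by algebra
    then show ?thesis
      using abcd by (simp add: field_simps)
  qed
  show ?p if p: "p \<in> {-1..m+1}"
  proof -
    consider "p = i" | "p = i - 1" | "p \<le> i - 2" | "i + 1 \<le> p"
      by linarith
    then show ?thesis
    proof cases
      case 3
      then show ?thesis using supp le[of p "i - 2"] i p by (simp add: knot_value_def)
    next
      case 4
      then show ?thesis using supp le[of "i + 1" p] i p by (simp add: knot_value_def)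
    qed (use b c in \<open>simp_all add: e_def knot_value_def\<close>)
  qed
  show ?k if k: "k \<in> {1..m}"
  proof -
    consider "k = i" | "k = i - 1" | "k = i + 1" | "k \<le> i - 2" | "i + 2 \<le> k"
      by linarith
    then show ?thesis
    proof cases
      case 4
      then have "u (k - 1) \<le> u (i - 2)" "u k \<le> u (i - 2)"
        using i k by (auto intro!: le)
      then show ?thesis using supp 4 by (simp add: bb_mid_def)
    next
      case 5
      then have "u (i + 1) \<le> u (k - 1)" "u (i + 1) \<le> u k"
        using i k by (auto intro!: le)
      then show ?thesis using supp 5 by (simp add: bb_mid_def)
    qed (use ab cd in simp_all)
  qed
qed

section \<open>Classical B-splines on the grid lines\<close>

lemma octagon_subset_box:
  assumes "u (i - 2) \<le> u (i - 1)" "u (i - 1) \<le> u i" "u i \<le> u (i + 1)"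
    and "v (j - 2) \<le> v (j - 1)" "v (j - 1) \<le> v j" "v j \<le> v (j + 1)"
  shows "octagon u v i j \<subseteq> {u (i - 2)..u (i + 1)} \<times> {v (j - 2)..v (j + 1)}"
  unfolding octagon_def using assms
  by (intro hull_minimal convex_Times) auto

lemma C1_on_UNIV_differentiable:
  assumes "C1_on UNIV g"
  shows "g differentiable (at V)"
  using C1_on_has_derivative[of UNIV UNIV g "fst V" "snd V"] assms
  by (auto simp: differentiable_def)

text \<open>Each restriction to a grid line is a multiple of a univariate B-spline. Comparing the
  horizontal and vertical multiples at the grid points and using the normalization fixes them
  all.\<close>

lemma classical_bspline_on_grid:
  assumes B: "is_classical_bspline m n u v i j B"
    and u: "strict_mono_on {-2..m+2} u" and v: "strict_mono_on {-2..n+2} v"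
    and i: "i \<in> {0..m+1}" and j: "j \<in> {0..n+1}" and mn: "1 \<le> m" "1 \<le> n"
  shows "p \<in> {-1..m+1} \<Longrightarrow> q \<in> {-1..n+1} \<Longrightarrow> B (u p, v q) = knot_value u i p * knot_value v j q"
    and "k \<in> {1..m} \<Longrightarrow> q \<in> {-1..n+1} \<Longrightarrow>
      bb_mid B (u (k - 1), v q) (u k, v q) = (if k = i then 1 else 0) * knot_value v j q"
    and "p \<in> {-1..m+1} \<Longrightarrow> l \<in> {1..n} \<Longrightarrow>
      bb_mid B (u p, v (l - 1)) (u p, v l) = knot_value u i p * (if l = j then 1 else 0)"
proof -
  have lessu: "u p < u q" if "p < q" "-2 \<le> p" "q \<le> m + 2" for p q
    using u that by (auto simp: strict_mono_on_def)
  have lessv: "v p < v q" if "p < q" "-2 \<le> p" "q \<le> n + 2" for p q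
    using v that by (auto simp: strict_mono_on_def)
  have diff: "B differentiable (at V)" for V
    using B by (auto simp: is_classical_bspline_def intro: C1_on_UNIV_differentiable)
  have "octagon u v i j \<subseteq> {u (i - 2)..u (i + 1)} \<times> {v (j - 2)..v (j + 1)}"
    using i j by (intro octagon_subset_box less_imp_le[OF lessu] less_imp_le[OF lessv]) auto
  then have supp: "B (s, t) = 0" if "s < u (i - 2) \<or> u (i + 1) < s \<or> t < v (j - 2) \<or> v (j + 1) < t" for s t
    using B that unfolding is_classical_bspline_def by fastforce
  have poly: "poly_deg_le_on 2 T B"
    if "T \<in> criss_cross_cell (u (k - 1)) (u k) (v (l - 1)) (v l)" "k \<in> {-1..m+2}" "l \<in> {-1..n+2}" for T k l
    using B that unfolding is_classical_bspline_def criss_cross_def by blast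
  have hor: "quadratic_on_segment (\<lambda>t. B (t, v q)) (u (k - 1)) (u k)"
    if "k \<in> {-1..m+2}" "q \<in> {-1..n+1}" for k q
  proof -
    \<comment> \<open>The segment is the bottom edge of the cell above it, which belongs to the
      triangulation since \<open>q + 1 \<le> n + 2\<close>.\<close>
    have "quadratic_on_segment B (u (k - 1), v q) (u k, v q)"
      by (rule poly_quadratic_on_segment[OF poly[of "convex hull
            {((u (k - 1) + u k) / 2, (v q + v (q + 1)) / 2), (u (k - 1), v q), (u k, v q)}" k "q + 1"]])
         (use that in \<open>auto simp: criss_cross_cell_def Let_def intro: hull_inc\<close>)
    then show ?thesis
      by (simp add: quadratic_on_segment_def bb_mid_def flip: scaleR_add_left)
  qed
  have ver: "quadratic_on_segment (\<lambda>t. B (u p, t)) (v (l - 1)) (v l)"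
    if "l \<in> {-1..n+2}" "p \<in> {-1..m+1}" for l p
  proof -
    have "quadratic_on_segment B (u p, v (l - 1)) (u p, v l)"
      by (rule poly_quadratic_on_segment[OF poly[of "convex hull
            {((u p + u (p + 1)) / 2, (v (l - 1) + v l) / 2), (u p, v l), (u p, v (l - 1))}" "p + 1" l]])
         (use that in \<open>auto simp: criss_cross_cell_def Let_def intro: hull_inc\<close>)
    then show ?thesis
      by (simp add: quadratic_on_segment_def bb_mid_def flip: scaleR_add_left)
  qed
  have hdiff: "(\<lambda>t. B (t, y)) differentiable (at t)" for y t
    using differentiable_chain_at[of "\<lambda>t. (t, y)" t B] diff
    by (auto simp: o_def intro!: derivative_intros)
  have vdiff: "(\<lambda>t. B (x, t)) differentiable (at t)" for x t
    using differentiable_chain_at[of "\<lambda>t. (x, t)" t B] diff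
    by (auto simp: o_def intro!: derivative_intros)
  have hsupp: "B (t, y) = 0" if "t < u (i - 2) \<or> u (i + 1) < t" for t y
    using that supp by blast
  have vsupp: "B (x, t) = 0" if "t < v (j - 2) \<or> v (j + 1) < t" for t x
    using that supp by blast
  define H where "H q = bb_mid (\<lambda>t. B (t, v q)) (u (i - 1)) (u i)" for q
  define V where "V p = bb_mid (\<lambda>t. B (u p, t)) (v (j - 1)) (v j)" for p
  have Hp: "B (u p, v q) = H q * knot_value u i p" if "p \<in> {-1..m+1}" "q \<in> {-1..n+1}" for p q
    unfolding H_def
    using quadratic_spline_on_three_intervals(1)[OF u i hdiff hor[OF _ that(2)] hsupp that(1)] by auto
  have Hk: "bb_mid (\<lambda>t. B (t, v q)) (u (k - 1)) (u k) = (if k = i then H q else 0)"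
    if "k \<in> {1..m}" "q \<in> {-1..n+1}" for k q
    unfolding H_def
    using quadratic_spline_on_three_intervals(2)[OF u i hdiff hor[OF _ that(2)] hsupp that(1)] by auto
  have Vq: "B (u p, v q) = V p * knot_value v j q" if "p \<in> {-1..m+1}" "q \<in> {-1..n+1}" for p q
    unfolding V_def
    using quadratic_spline_on_three_intervals(1)[OF v j vdiff ver[OF _ that(1)] vsupp that(2)] by auto
  have Vl: "bb_mid (\<lambda>t. B (u p, t)) (v (l - 1)) (v l) = (if l = j then V p else 0)"
    if "l \<in> {1..n}" "p \<in> {-1..m+1}" for l p
    unfolding V_def
    using quadratic_spline_on_three_intervals(2)[OF v j vdiff ver[OF _ that(2)] vsupp that(1)] by auto
  have norm: "B (u i, v j) = knot_value u i i * knot_value v j j"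
    using B by (simp add: is_classical_bspline_def knot_value_def)
  have pos: "knot_value u i i > 0" "knot_value v j j > 0"
    using lessu[of i "i + 1"] lessu[of "i - 1" i] lessv[of j "j + 1"] lessv[of "j - 1" j] i j
    by (auto simp: knot_value_def)
  \<comment> \<open>The two factorizations are matched first at \<open>(u i, v j)\<close>, where the
    normalization applies, then along the line \<open>u i\<close>, and finally along the line
    \<open>v j\<close>.\<close>
  have Vi: "V i = knot_value u i i"
    using Vq[of i j] norm pos i j by simp
  have H: "H q = knot_value v j q" if "q \<in> {-1..n+1}" for q
    using Hp[of i q] Vq[of i q] Vi pos i that by simp
  have V: "V p = knot_value u i p" if "p \<in> {-1..m+1}" for p
    using Hp[of p j] Vq[of p j] H[of j] pos j that by simp
  show "p \<in> {-1..m+1} \<Longrightarrow> q \<in> {-1..n+1} \<Longrightarrow> B (u p, v q) = knot_value u i p * knot_value v j q"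
    using Hp H by simp
  show "k \<in> {1..m} \<Longrightarrow> q \<in> {-1..n+1} \<Longrightarrow>
      bb_mid B (u (k - 1), v q) (u k, v q) = (if k = i then 1 else 0) * knot_value v j q"
    using Hk[of k q] H[of q] by (simp add: bb_mid_def flip: scaleR_add_left)
  show "p \<in> {-1..m+1} \<Longrightarrow> l \<in> {1..n} \<Longrightarrow>
      bb_mid B (u p, v (l - 1)) (u p, v l) = knot_value u i p * (if l = j then 1 else 0)"
    using Vl[of l p] V[of p] by (simp add: bb_mid_def flip: scaleR_add_left)
qed

text \<open>The Bernstein coefficients on \<open>[u (k - 1), u k]\<close>, indexed by \<open>a \<in> {0, 1, 2}\<close>, of the univariate
  B-spline with index \<open>p\<close>, and below those of its \<open>alpha\<close>-combinations.\<close>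

definition cell_coef :: "(int \<Rightarrow> real) \<Rightarrow> int \<Rightarrow> int \<Rightarrow> nat \<Rightarrow> real" where
  "cell_coef u k p a =
     (if a = 0 then knot_value u p (k - 1) else if a = 1 then (if k = p then 1 else 0) else knot_value u p k)"

definition clamped_coef :: "int \<Rightarrow> (int \<Rightarrow> real) \<Rightarrow> int \<Rightarrow> int \<Rightarrow> nat \<Rightarrow> real" where
  "clamped_coef m u k i a = (\<Sum>p=0..m+1. alpha m u i p * cell_coef u k p a)"

section \<open>Univariate sums with triple boundary knots\<close>

lemma sum_knot_value:
  assumes "r \<in> {0..m}"
  shows "(\<Sum>p=0..m+1. F p * knot_value u p r)
           = F r * knot_value u r r + F (r + 1) * knot_value u (r + 1) r"
proof -
  have "(\<Sum>p=0..m+1. F p * knot_value u p r) = (\<Sum>p\<in>{r, r + 1}. F p * knot_value u p r)"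
    using assms by (intro sum.mono_neutral_right) (auto simp: knot_value_def)
  then show ?thesis by simp
qed

text \<open>The matrix \<open>alpha\<close> turns the B-splines with simple boundary knots into those with triple
  boundary knots.\<close>

lemma clamped_knot_value:
  assumes m: "1 \<le> m" and u: "strict_mono_on {-2..m+2} u"
    and i: "i \<in> {0..m+1}" and r: "r \<in> {0..m}"
  shows "(\<Sum>p=0..m+1. alpha m u i p * knot_value u p r)
    = (if r = 0 then (if i = 0 then 1 else 0) else if r = m then (if i = m + 1 then 1 else 0)
       else if i = r \<or> i = r + 1 then knot_value u i r else 0)"
proof -
  have less: "u p < u q" if "p < q" "-2 \<le> p" "q \<le> m + 2" for p q
    using u that by (auto simp: strict_mono_on_def)
  \<comment> \<open>The columns 1 to \<open>m\<close> of \<open>alpha\<close> are unit columns; the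
    boundary corrections sit in the columns 0 and \<open>m + 1\<close>.\<close>
  have inner: "alpha m u i p = (if i = p then 1 else 0)" if "p \<in> {1..m}" for p
    using that by (auto simp: alpha_def Let_def)
  have first: "alpha m u i 0 = (if i = 0 then (u 1 - u (-1)) / (u 1 - u 0)
      else if i = 1 then - ((u 0 - u (-1)) / (u 1 - u 0)) else 0)"
    using m by (auto simp: alpha_def Let_def)
  have last: "alpha m u i (m + 1) = (if i = m + 1 then (u (m + 1) - u (m - 1)) / (u m - u (m - 1))
      else if i = m then - ((u (m + 1) - u m) / (u m - u (m - 1))) else 0)"
    using m by (auto simp: alpha_def Let_def)
  consider "r = 0" | "r = m" | "r \<in> {1..m - 1}"
    using r by fastforce
  then show ?thesis
  proof cases
    case 1
    \<comment> \<open>The entry \<open>alpha m u 0 0\<close> scales the first spline to the value 1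
      at \<open>u 0\<close>, and \<open>alpha m u 1 0\<close> cancels the value there of the spline
      with index 1.\<close>
    have "u (-1) < u 0" "u 0 < u 1"
      using m by (auto intro!: less)
    then show ?thesis
      unfolding sum_knot_value[OF r] unfolding 1 using m first inner[of 1]
      by (simp add: knot_value_def divide_simps)
  next
    case 2
    have "u (m - 1) < u m" "u m < u (m + 1)"
      using m by (auto intro!: less)
    then show ?thesis
      unfolding sum_knot_value[OF r] unfolding 2 using m last inner[of m]
      by (simp add: knot_value_def divide_simps add.commute[of 1])
  next
    case 3
    then show ?thesis
      unfolding sum_knot_value[OF r] using m inner[of r] inner[of "r + 1"] by auto
  qed
qed

lemma sum_clamped_knot_value:
  assumes m: "1 \<le> m" and u: "strict_mono_on {-2..m+2} u" and r: "r \<in> {0..m}"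
  shows "(\<Sum>i=0..m+1. (\<Sum>p=0..m+1. alpha m u i p * knot_value u p r) * F i)
    = (if r = 0 then F 0 else if r = m then F (m + 1)
       else knot_value u r r * F r + knot_value u (r + 1) r * F (r + 1))"
proof -
  let ?f = "\<lambda>i. (if r = 0 then (if i = 0 then 1 else 0) else if r = m then (if i = m + 1 then 1 else 0)
       else if i = r \<or> i = r + 1 then knot_value u i r else 0) * F i"
  let ?T = "if r = 0 then {0} else if r = m then {m + 1} else {r, r + 1}"
  have "(\<Sum>i=0..m+1. (\<Sum>p=0..m+1. alpha m u i p * knot_value u p r) * F i) = (\<Sum>i=0..m+1. ?f i)"
    by (rule sum.cong[OF refl]) (simp only: clamped_knot_value[OF m u _ r])
  also have "\<dots> = sum ?f ?T"
    using r m by (intro sum.mono_neutral_right) auto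
  finally show ?thesis by simp
qed

lemma clamped_coef_mid:
  assumes k: "k \<in> {1..m}" and i: "i \<in> {0..m+1}"
  shows "clamped_coef m u k i 1 = (if i = k then 1 else 0)"
proof -
  have "clamped_coef m u k i 1 = (\<Sum>p=0..m+1. if k = p then alpha m u i p else 0)"
    unfolding clamped_coef_def cell_coef_def by (intro sum.cong) auto
  also have "\<dots> = alpha m u i k"
    using k by simp
  also have "\<dots> = (if i = k then 1 else 0)"
    using k by (auto simp: alpha_def Let_def)
  finally show ?thesis .
qed

text \<open>As \<open>alpha\<close> has negative entries, the sign is read off from the evaluated
  sums, which are 0, 1 or knot values.\<close>

lemma clamped_coef_nonneg:
  assumes m: "1 \<le> m" and u: "strict_mono_on {-2..m+2} u"
    and k: "k \<in> {1..m}" and i: "i \<in> {0..m+1}" and a: "a \<le> 2"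
  shows "clamped_coef m u k i a \<ge> 0"
proof -
  have less: "u p < u q" if "p < q" "-2 \<le> p" "q \<le> m + 2" for p q
    using u that by (auto simp: strict_mono_on_def)
  have nonneg: "knot_value u i r \<ge> 0" for r
    using i less[of i "i + 1"] less[of "i - 1" i] less[of "i - 2" "i - 1"]
    by (auto simp: knot_value_def)
  consider "a = 0" | "a = 1" | "a = 2"
    using a by linarith
  then show ?thesis
  proof cases
    case 2
    then show ?thesis using clamped_coef_mid[OF k i] by simp
  qed (use k nonneg clamped_knot_value[OF m u i, of "k - 1"] clamped_knot_value[OF m u i, of k] in
      \<open>auto simp: clamped_coef_def cell_coef_def\<close>)
qed

text \<open>Marsden's identity for quadratic splines: with the mean and the product of two
  consecutive knots as coefficients, the splines reproduce the first and second powers. The three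
  constants treat all quadratics at once.\<close>

lemma sum_clamped_coef:
  assumes m: "1 \<le> m" and u: "extends_partition m x u" and k: "k \<in> {1..m}" and a: "a \<le> 2"
  shows "(\<Sum>i=0..m+1. clamped_coef m u k i a
             * (c0 + c1 * midpt m x i + c2 * (node m x (i - 1) * node m x i)))
    = c0 + c1 * ([x (k - 1), (x (k - 1) + x k) / 2, x k] ! a)
      + c2 * ([(x (k - 1))\<^sup>2, x (k - 1) * x k, (x k)\<^sup>2] ! a)"
proof -
  have mono: "strict_mono_on {-2..m+2} u" and ux: "\<And>i. i \<in> {0..m} \<Longrightarrow> x i = u i"
    using u by (auto simp: extends_partition_def)
  have less: "u p < u q" if "p < q" "-2 \<le> p" "q \<le> m + 2" for p q
    using mono that by (auto simp: strict_mono_on_def)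
  have node: "node m x i = u i" if "i \<in> {0..m}" for i
    using that ux by (simp add: node_def)
  \<comment> \<open>The conventions of \<open>node\<close> act as repeated end knots, so the
    outermost coefficients are the values of the quadratic at the two ends.\<close>
  have ends: "node m x (-1) = u 0" "node m x (m + 1) = u m"
    using m ux by (auto simp: node_def)
  define F where "F i = c0 + c1 * midpt m x i + c2 * (node m x (i - 1) * node m x i)" for i
  have at_knot: "(\<Sum>i=0..m+1. (\<Sum>p=0..m+1. alpha m u i p * knot_value u p r) * F i)
      = c0 + c1 * u r + c2 * (u r)\<^sup>2" if r: "r \<in> {0..m}" for r
    unfolding sum_clamped_knot_value[OF m mono r]
  proof -
    consider "r = 0" | "r = m" "r \<noteq> 0" | "r \<in> {1..m - 1}"
      using r by fastforce
    then show "(if r = 0 then F 0 else if r = m then F (m + 1)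
       else knot_value u r r * F r + knot_value u (r + 1) r * F (r + 1)) = c0 + c1 * u r + c2 * (u r)\<^sup>2"
    proof cases
      case 3
      then have "u (r - 1) < u r" "u r < u (r + 1)"
        by (auto intro!: less)
      then have h: "u (r + 1) - u (r - 1) > 0" by simp
      have "midpt m x r = (u (r - 1) + u r) / 2" "midpt m x (r + 1) = (u r + u (r + 1)) / 2"
        using 3 by (simp_all add: midpt_def node)
      then have "F r = c0 + c1 * ((u (r - 1) + u r) / 2) + c2 * (u (r - 1) * u r)"
        "F (r + 1) = c0 + c1 * ((u r + u (r + 1)) / 2) + c2 * (u r * u (r + 1))"
        using 3 by (simp_all add: F_def node)
      moreover have "knot_value u r r = (u (r + 1) - u r) / (u (r + 1) - u (r - 1))"
        "knot_value u (r + 1) r = (u r - u (r - 1)) / (u (r + 1) - u (r - 1))"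
        by (simp_all add: knot_value_def)
      ultimately have "(knot_value u r r * F r + knot_value u (r + 1) r * F (r + 1))
          * (u (r + 1) - u (r - 1)) = (c0 + c1 * u r + c2 * (u r)\<^sup>2) * (u (r + 1) - u (r - 1))"
        using h by (simp add: distrib_right) (simp add: field_simps power2_eq_square)
      then show ?thesis using 3 h by simp
    qed (use m ends node in \<open>simp_all add: F_def midpt_def power2_eq_square\<close>)
  qed
  consider "a = 0" | "a = 1" | "a = 2"
    using a by linarith
  then have "(\<Sum>i=0..m+1. clamped_coef m u k i a * F i)
    = c0 + c1 * ([x (k - 1), (x (k - 1) + x k) / 2, x k] ! a)
      + c2 * ([(x (k - 1))\<^sup>2, x (k - 1) * x k, (x k)\<^sup>2] ! a)"
  proof cases
    case 1
    then show ?thesis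
      using at_knot[of "k - 1"] k ux by (simp add: clamped_coef_def cell_coef_def)
  next
    case 2
    have "(\<Sum>i=0..m+1. clamped_coef m u k i 1 * F i) = (\<Sum>i=0..m+1. if i = k then F i else 0)"
      by (rule sum.cong[OF refl]) (simp only: clamped_coef_mid[OF k], simp)
    then show ?thesis
      using 2 k ux by (simp add: F_def midpt_def node)
  next
    case 3
    then show ?thesis
      using at_knot[of k] k ux by (simp add: clamped_coef_def cell_coef_def)
  qed
  then show ?thesis
    by (simp add: F_def)
qed

section \<open>Assembly of the bivariate B-splines\<close>

lemma partition_cell:
  assumes x: "is_partition m a b x" and s: "s \<in> {a..b}"
  obtains k where "k \<in> {1..m}" "s \<in> {x (k - 1)..x k}"
proof -
  have m: "1 \<le> m" and ab: "x 0 = a" "x m = b"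
    using x by (auto simp: is_partition_def)
  have "\<exists>k\<in>{1..int N}. s \<in> {x (k - 1)..x k}" if "s \<in> {x 0..x (int N)}" "N \<ge> 1" for N
    using that
  proof (induction N)
    case (Suc N)
    show ?case
    proof (cases "s \<le> x (int N) \<and> N \<ge> 1")
      case True
      then show ?thesis using Suc by force
    next
      case False
      then have "s \<in> {x (int (Suc N) - 1)..x (int (Suc N))}"
        using Suc.prems by (cases "N = 0") auto
      then show ?thesis by (intro bexI[of _ "int (Suc N)"]) auto
    qed
  qed simp
  from this[of "nat m"] show thesis
    using that m ab s by force
qed

text \<open>With the weights \<open>w\<close> pulled out, the two directions are summed separately.
  This serves for the \<open>alpha\<close>-combinations and again for sums over all
  B-splines.\<close>

lemma sum_bilinear:
  fixes f g :: "'i \<Rightarrow> real"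
  shows "(\<Sum>i\<in>I. \<Sum>j\<in>J. f i * g j * (\<Sum>a\<le>2::nat. \<Sum>b\<le>2::nat. w a b * (X i a * Y j b)))
    = (\<Sum>a\<le>2. \<Sum>b\<le>2. w a b * ((\<Sum>i\<in>I. f i * X i a) * (\<Sum>j\<in>J. g j * Y j b)))"
  unfolding sum_product
  unfolding sum_atMost_2 sum_distrib_left sum.distrib[symmetric]
  by (intro sum.cong refl) (simp add: algebra_simps)

text \<open>All classical B-splines share the weights \<open>w\<close>, so the
  \<open>alpha\<close>-combinations act on the univariate coefficients alone.\<close>

lemma bspline_on_cell:
  assumes m: "1 \<le> m" and n: "1 \<le> n"
    and u: "extends_partition m x u" and v: "extends_partition n y v"
    and B: "\<And>i j. i \<in> {0..m+1} \<Longrightarrow> j \<in> {0..n+1} \<Longrightarrow> is_classical_bspline m n u v i j (Bbar i j)"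
    and k: "k \<in> {1..m}" and l: "l \<in> {1..n}"
    and w: "\<And>g X Y. cell_spline (x (k - 1)) (x k) (y (l - 1)) (y l) g \<Longrightarrow>
      product_boundary g (x (k - 1)) (x k) (y (l - 1)) (y l) X Y \<Longrightarrow>
      g P = (\<Sum>a\<le>2. \<Sum>b\<le>2. w a b * (X a * Y b))"
  shows "bspline m n u v Bbar i j P
    = (\<Sum>a\<le>2. \<Sum>b\<le>2. w a b * (clamped_coef m u k i a * clamped_coef n v l j b))"
proof -
  have mu: "strict_mono_on {-2..m+2} u" and ux: "\<And>i. i \<in> {0..m} \<Longrightarrow> x i = u i"
    using u by (auto simp: extends_partition_def)
  have mv: "strict_mono_on {-2..n+2} v" and vy: "\<And>i. i \<in> {0..n} \<Longrightarrow> y i = v i"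
    using v by (auto simp: extends_partition_def)
  have cell: "Bbar p q P = (\<Sum>a\<le>2. \<Sum>b\<le>2. w a b * (cell_coef u k p a * cell_coef v l q b))"
    if p: "p \<in> {0..m+1}" and q: "q \<in> {0..n+1}" for p q
  proof (rule w)
    have "C1_on UNIV (Bbar p q)" and "\<forall>T\<in>criss_cross m n u v. poly_deg_le_on 2 T (Bbar p q)"
      using B[OF p q] by (auto simp: is_classical_bspline_def)
    moreover have "criss_cross_cell (u (k - 1)) (u k) (v (l - 1)) (v l) \<subseteq> criss_cross m n u v"
      unfolding criss_cross_def using k l by force
    ultimately show "cell_spline (x (k - 1)) (x k) (y (l - 1)) (y l) (Bbar p q)"
      using k l ux vy by (auto simp: cell_spline_def C1_on_UNIV_differentiable)
    show "product_boundary (Bbar p q) (x (k - 1)) (x k) (y (l - 1)) (y l) (cell_coef u k p) (cell_coef v l q)"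
      using classical_bspline_on_grid[OF B[OF p q] mu mv p q m n] k l ux vy
      by (auto simp: product_boundary_def cell_coef_def)
  qed
  have "bspline m n u v Bbar i j P = (\<Sum>p=0..m+1. \<Sum>q=0..n+1. alpha m u i p * alpha n v j q
          * (\<Sum>a\<le>2. \<Sum>b\<le>2. w a b * (cell_coef u k p a * cell_coef v l q b)))"
    unfolding bspline_def by (intro sum.cong refl) (simp only: cell)
  also have "\<dots> = (\<Sum>a\<le>2. \<Sum>b\<le>2. w a b * ((\<Sum>p=0..m+1. alpha m u i p * cell_coef u k p a)
          * (\<Sum>q=0..n+1. alpha n v j q * cell_coef v l q b)))"
    by (rule sum_bilinear)
  finally show ?thesis
    by (simp add: clamped_coef_def)
qed

text \<open>Sums over the B-splines factor inside each cell weight: one direction contributes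
  Marsden's identity, the other the partition of unity.\<close>

lemma bspline_reproduction:
  assumes x: "is_partition m a b x" and y: "is_partition n c d y"
    and u: "extends_partition m x u" and v: "extends_partition n y v"
    and B: "\<And>i j. i \<in> {0..m+1} \<Longrightarrow> j \<in> {0..n+1} \<Longrightarrow> is_classical_bspline m n u v i j (Bbar i j)"
    and P: "P \<in> {a..b} \<times> {c..d}"
  shows "\<And>i j. i \<in> {0..m+1} \<Longrightarrow> j \<in> {0..n+1} \<Longrightarrow> bspline m n u v Bbar i j P \<ge> 0"
    and "(\<Sum>i=0..m+1. \<Sum>j=0..n+1. bspline m n u v Bbar i j P
            * (c0 + c1 * midpt m x i + c2 * (node m x (i - 1) * node m x i)))
         = c0 + c1 * fst P + c2 * (fst P)\<^sup>2"
    and "(\<Sum>i=0..m+1. \<Sum>j=0..n+1. bspline m n u v Bbar i j P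
            * (c0 + c1 * midpt n y j + c2 * (node n y (j - 1) * node n y j)))
         = c0 + c1 * snd P + c2 * (snd P)\<^sup>2"
proof -
  have m: "1 \<le> m" and n: "1 \<le> n"
    using x y by (auto simp: is_partition_def)
  have mu: "strict_mono_on {-2..m+2} u" and mv: "strict_mono_on {-2..n+2} v"
    using u v by (auto simp: extends_partition_def)
  have P': "fst P \<in> {a..b}" "snd P \<in> {c..d}"
    using P by auto
  obtain k where k: "k \<in> {1..m}" "fst P \<in> {x (k - 1)..x k}"
    by (rule partition_cell[OF x P'(1)])
  obtain l where l: "l \<in> {1..n}" "snd P \<in> {y (l - 1)..y l}"
    by (rule partition_cell[OF y P'(2)])
  have "x (k - 1) < x k" "y (l - 1) < y l"
    using x y k l by (auto simp: is_partition_def strict_mono_on_def)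
  from criss_cross_cell_covers[OF this k(2) l(2)]
  obtain w where w0: "\<And>a b. 0 \<le> w a b"
    and w: "\<And>g X Y. cell_spline (x (k - 1)) (x k) (y (l - 1)) (y l) g \<Longrightarrow>
      product_boundary g (x (k - 1)) (x k) (y (l - 1)) (y l) X Y \<Longrightarrow>
      g P = (\<Sum>a\<le>2. \<Sum>b\<le>2. w a b * (X a * Y b))"
    using criss_cross_weights[of P "x (k - 1)" "x k" "y (l - 1)" "y l"] by auto
  have cell: "bspline m n u v Bbar i j P
      = (\<Sum>a\<le>2. \<Sum>b\<le>2. w a b * (clamped_coef m u k i a * clamped_coef n v l j b))" for i j
    by (rule bspline_on_cell[OF m n u v B k(1) l(1) w])
  show "bspline m n u v Bbar i j P \<ge> 0" if "i \<in> {0..m+1}" "j \<in> {0..n+1}" for i j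
    unfolding cell using that w0
    by (intro sum_nonneg mult_nonneg_nonneg clamped_coef_nonneg m n mu mv k(1) l(1)) auto
  have swap: "(\<Sum>i=0..m+1. \<Sum>j=0..n+1. bspline m n u v Bbar i j P * (F i * G j))
      = (\<Sum>a\<le>2. \<Sum>b\<le>2. w a b * ((\<Sum>i=0..m+1. clamped_coef m u k i a * F i)
          * (\<Sum>j=0..n+1. clamped_coef n v l j b * G j)))" for F G
    using sum_bilinear[of F G w "clamped_coef m u k" "clamped_coef n v l" "{0..n+1}" "{0..m+1}"]
    unfolding cell by (simp only: mult_ac)
  have one_x: "(\<Sum>i=0..m+1. clamped_coef m u k i a) = 1" if "a \<le> 2" for a
    using sum_clamped_coef[OF m u k(1) that, of 1 0 0] by simp
  have one_y: "(\<Sum>j=0..n+1. clamped_coef n v l j b) = 1" if "b \<le> 2" for b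
    using sum_clamped_coef[OF n v l(1) that, of 1 0 0] by simp
  \<comment> \<open>The weights that evaluate the B-splines at \<open>P\<close> also evaluate the
    quadratic itself, which turns coefficients back into a value.\<close>
  have wx: "(\<Sum>a\<le>2. \<Sum>b\<le>2. w a b * (c0 + c1 * ([x (k - 1), (x (k - 1) + x k) / 2, x k] ! a)
      + c2 * ([(x (k - 1))\<^sup>2, x (k - 1) * x k, (x k)\<^sup>2] ! a))) = c0 + c1 * fst P + c2 * (fst P)\<^sup>2"
    by (rule quadratic_weights(1)[OF w])
  show "(\<Sum>i=0..m+1. \<Sum>j=0..n+1. bspline m n u v Bbar i j P
            * (c0 + c1 * midpt m x i + c2 * (node m x (i - 1) * node m x i)))
         = c0 + c1 * fst P + c2 * (fst P)\<^sup>2"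
    using swap[of "\<lambda>i. c0 + c1 * midpt m x i + c2 * (node m x (i - 1) * node m x i)" "\<lambda>_. 1"]
    by (simp add: sum_clamped_coef[OF m u k(1)] one_y wx cong: sum.cong_simp)
  have wy: "(\<Sum>a\<le>2. \<Sum>b\<le>2. w a b * (c0 + c1 * ([y (l - 1), (y (l - 1) + y l) / 2, y l] ! b)
      + c2 * ([(y (l - 1))\<^sup>2, y (l - 1) * y l, (y l)\<^sup>2] ! b))) = c0 + c1 * snd P + c2 * (snd P)\<^sup>2"
    by (rule quadratic_weights(2)[OF w])
  show "(\<Sum>i=0..m+1. \<Sum>j=0..n+1. bspline m n u v Bbar i j P
            * (c0 + c1 * midpt n y j + c2 * (node n y (j - 1) * node n y j)))
         = c0 + c1 * snd P + c2 * (snd P)\<^sup>2"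
    using swap[of "\<lambda>_. 1" "\<lambda>j. c0 + c1 * midpt n y j + c2 * (node n y (j - 1) * node n y j)"]
    by (simp add: sum_clamped_coef[OF n v l(1)] one_x wy cong: sum.cong_simp)
qed


section \<open>Error of the quasi-interpolants\<close>

lemma node_mono:
  assumes "is_partition m a b x" "i \<le> j"
  shows "node m x i \<le> node m x j"
proof -
  have "x k \<le> x l" if "0 \<le> k" "k \<le> l" "l \<le> m" for k l
    using assms that by (cases "k = l") (auto simp: is_partition_def strict_mono_on_def less_imp_le)
  then show ?thesis
    using assms by (auto simp: node_def is_partition_def)
qed

lemma node_in_interval:
  assumes "is_partition m a b x"
  shows "node m x i \<in> {a..b}"
proof -
  have "node m x (min 0 i) = a" "node m x (max m i) = b"
    using assms by (auto simp: node_def is_partition_def)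
  then show ?thesis
    using node_mono[OF assms, of "min 0 i" i] node_mono[OF assms, of i "max m i"] by auto
qed

lemma midpt_in_interval:
  assumes "is_partition m a b x"
  shows "midpt m x i \<in> {a..b}"
  using node_in_interval[OF assms, of i] node_in_interval[OF assms, of "i - 1"]
  by (auto simp: midpt_def)

lemma step_nonneg: "is_partition m a b x \<Longrightarrow> 0 \<le> step m x i"
  using node_mono[of m a b x "i - 1" i] by (simp add: step_def)

lemma step_pos:
  assumes "is_partition m a b x" "i \<in> {1..m}"
  shows "0 < step m x i"
  using assms by (auto simp: step_def node_def is_partition_def strict_mono_on_def)

lemma step_outside:
  assumes "i \<notin> {1..m}" "1 \<le> m"
  shows "step m x i = 0"
  using assms by (auto simp: step_def node_def max_def min_def)

lemma mesh_size_pos: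
  assumes "is_partition m a b x" "is_partition n c d y"
  shows "0 < mesh_size m n x y"
proof -
  have "1 \<le> m" using assms by (simp add: is_partition_def)
  then have "step m x 1 \<le> mesh_size m n x y"
    unfolding mesh_size_def by (intro Max_ge) auto
  then show ?thesis
    using step_pos[OF assms(1), of 1] \<open>1 \<le> m\<close> by simp
qed

lemma step_le_mesh_size:
  assumes "is_partition m a b x" "is_partition n c d y"
  shows "step m x i \<le> mesh_size m n x y" "step n y j \<le> mesh_size m n x y"
proof -
  have "1 \<le> m" "1 \<le> n" using assms by (simp_all add: is_partition_def)
  then show "step m x i \<le> mesh_size m n x y"
    using mesh_size_pos[OF assms] step_outside[of i m x] unfolding mesh_size_def
    by (cases "i \<in> {1..m}") (auto intro!: Max_ge)
  show "step n y j \<le> mesh_size m n x y"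
    using mesh_size_pos[OF assms] step_outside[of j n y] \<open>1 \<le> n\<close> unfolding mesh_size_def
    by (cases "j \<in> {1..n}") (auto intro!: Max_ge)
qed

text \<open>The boundary values of \<open>sigma\<close> agree with the general formula, because the steps
  \<open>0\<close> and \<open>m + 1\<close> vanish.\<close>

lemma sigma_eq:
  assumes "is_partition m a b x" "i \<in> {1..m+1}"
  shows "sigma m x i = step m x i / (step m x (i - 1) + step m x i)"
proof -
  have m: "1 \<le> m" using assms by (simp add: is_partition_def)
  have "0 < step m x 1"
    using step_pos[OF assms(1), of 1] m by simp
  then show ?thesis
    using assms(2) m step_outside[of 0 m x] step_outside[of "m + 1" m x]
    by (cases "i = m + 1") (auto simp: sigma_def)
qed

section \<open>Second differences on nonuniform partitions\<close>

text \<open>Because \<open>2 * L\<close> and \<open>2 * R\<close> are sums of two neighbouring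
  steps, both \<open>sigma\<close> terms are ratios with numerator \<open>step m x i\<close>. The
  coefficients then share the factor \<open>(step m x i)\<^sup>2 / (4 * (L + R))\<close>, so they
  form a difference of two slopes.\<close>

lemma coef_eq:
  assumes x: "is_partition m a b x" and i: "i \<in> {1..m}"
  defines "L \<equiv> midpt m x i - midpt m x (i - 1)" and "R \<equiv> midpt m x (i + 1) - midpt m x i"
  shows "coef_a m x i = - ((step m x i)\<^sup>2 / (4 * (L + R)) / L)"
    and "coef_c m x i = - ((step m x i)\<^sup>2 / (4 * (L + R)) / R)"
    and "step m x i / 2 \<le> L" and "step m x i / 2 \<le> R"
proof -
  let ?H = "step m x i"
  have H: "0 < ?H" by (rule step_pos[OF x i])
  have L2: "2 * L = step m x (i - 1) + ?H" and R2: "2 * R = ?H + step m x (i + 1)"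
    by (simp_all add: L_def R_def midpt_def step_def field_simps)
  show L: "?H / 2 \<le> L" and R: "?H / 2 \<le> R"
    using L2 R2 step_nonneg[OF x, of "i - 1"] step_nonneg[OF x, of "i + 1"] by simp_all
  have pos: "0 < L" "0 < R" using H L R by linarith+
  have s: "sigma m x i = ?H / (2 * L)"
    using sigma_eq[OF x, of i] i by (simp add: L2)
  have "sigma m x (i + 1) = (2 * R - ?H) / (2 * R)"
    using sigma_eq[OF x, of "i + 1"] i by (simp add: R2)
  then have s': "sigma' m x (i + 1) = ?H / (2 * R)"
    using pos by (simp add: sigma'_def field_simps)
  have sum: "sigma m x i + sigma' m x (i + 1) = ?H * (L + R) / (2 * L * R)"
    unfolding s s' using pos by (simp add: field_simps)
  show "coef_a m x i = - (?H\<^sup>2 / (4 * (L + R)) / L)"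
    using i H pos unfolding coef_a_def sum unfolding s s' by (simp add: divide_simps power2_eq_square)
  show "coef_c m x i = - (?H\<^sup>2 / (4 * (L + R)) / R)"
    using i H pos unfolding coef_c_def sum unfolding s s' by (simp add: divide_simps power2_eq_square)
qed

text \<open>By the mean value theorem the expression is \<open>e\<close> times a difference of
  derivatives at points at most \<open>L + R\<close> apart. The constant 3/4 is
  \<open>1 / 4 + 1 / 2\<close>, free of mesh ratios. Stating it for an abstract pair
  \<open>\<phi>\<close>, \<open>\<phi>'\<close> covers both coordinate directions.\<close>

lemma second_difference_bound:
  fixes \<phi> \<phi>' :: "real \<Rightarrow> real"
  assumes x: "is_partition m a b x" and h: "0 < h" "step m x i \<le> h"
    and mvt: "\<And>p q. a \<le> p \<Longrightarrow> p \<le> q \<Longrightarrow> q \<le> b \<Longrightarrow> \<exists>\<xi>\<in>{p..q}. \<phi> q - \<phi> p = (q - p) * \<phi>' \<xi>"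
    and w: "\<And>p q. p \<in> {a..b} \<Longrightarrow> q \<in> {a..b} \<Longrightarrow> dist p q \<le> h / 2 \<Longrightarrow> \<bar>\<phi>' p - \<phi>' q\<bar> \<le> w"
  shows "\<bar>coef_a m x i * (\<phi> (midpt m x (i - 1)) - \<phi> (midpt m x i))
           + coef_c m x i * (\<phi> (midpt m x (i + 1)) - \<phi> (midpt m x i))\<bar> \<le> 3 / 4 * h * w"
proof -
  have w0: "0 \<le> w"
    using w[OF midpt_in_interval[OF x] midpt_in_interval[OF x]] h by (smt (verit) dist_self half_gt_zero)
  show ?thesis
  proof (cases "i \<in> {1..m}")
    case False
    then have "coef_a m x i = 0" "coef_c m x i = 0"
      by (auto simp: coef_a_def coef_c_def)
    then show ?thesis
      using h w0 by simp
  next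
    case i: True
    let ?H = "step m x i" and ?s = "midpt m x i"
    define L where "L = midpt m x i - midpt m x (i - 1)"
    define R where "R = midpt m x (i + 1) - midpt m x i"
    define e where "e = ?H\<^sup>2 / (4 * (L + R))"
    note coef = coef_eq[OF x i, folded L_def R_def]
    have H: "0 < ?H" by (rule step_pos[OF x i])
    have pos: "0 < L" "0 < R" using H coef(3,4) by linarith+
    have in_ab: "a \<le> midpt m x (i - 1)" "?s \<in> {a..b}" "midpt m x (i + 1) \<le> b"
      using midpt_in_interval[OF x] by auto
    obtain \<xi> where \<xi>: "\<xi> \<in> {midpt m x (i - 1)..?s}" "\<phi> ?s - \<phi> (midpt m x (i - 1)) = L * \<phi>' \<xi>"
      using mvt[of "midpt m x (i - 1)" ?s] in_ab pos by (auto simp: L_def)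
    obtain \<eta> where \<eta>: "\<eta> \<in> {?s..midpt m x (i + 1)}" "\<phi> (midpt m x (i + 1)) - \<phi> ?s = R * \<phi>' \<eta>"
      using mvt[of ?s "midpt m x (i + 1)"] in_ab pos by (auto simp: R_def)
    have \<xi>': "\<phi> (midpt m x (i - 1)) - \<phi> ?s = - (L * \<phi>' \<xi>)"
      using \<xi>(2) by simp
    have eq: "coef_a m x i * (\<phi> (midpt m x (i - 1)) - \<phi> ?s)
           + coef_c m x i * (\<phi> (midpt m x (i + 1)) - \<phi> ?s) = e * (\<phi>' \<xi> - \<phi>' \<eta>)"
      unfolding coef(1,2) \<xi>' \<eta>(2) e_def[symmetric] using pos by (simp add: field_simps)
    have "\<bar>\<phi>' \<xi> - \<phi>' \<eta>\<bar> \<le> (1 + dist \<xi> \<eta> / (h / 2)) * w"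
      by (rule bounded_increment_linear[of "{a..b}"]) (use w h \<xi> \<eta> in_ab in auto)
    also have "\<dots> \<le> (1 + (L + R) / (h / 2)) * w"
      using \<xi>(1) \<eta>(1) h w0
      by (intro mult_right_mono add_left_mono divide_right_mono) (auto simp: dist_real_def L_def R_def)
    finally have "\<bar>\<phi>' \<xi> - \<phi>' \<eta>\<bar> \<le> (1 + (L + R) / (h / 2)) * w" .
    moreover have e: "0 \<le> e"
      using pos by (simp add: e_def)
    ultimately have "e * \<bar>\<phi>' \<xi> - \<phi>' \<eta>\<bar> \<le> e * ((1 + (L + R) / (h / 2)) * w)"
      by (intro mult_left_mono)
    also have "\<dots> = (e + e * (L + R) / (h / 2)) * w"
      by (simp add: distrib_left)
    \<comment> \<open>The denominator \<open>L + R\<close> of \<open>e\<close> cancels the growth of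
      the increment bound.\<close>
    also have "e * (L + R) / (h / 2) = ?H\<^sup>2 / (2 * h)"
    proof -
      have "e * (L + R) = ?H\<^sup>2 / 4"
        using pos by (simp add: e_def divide_simps)
      then show ?thesis by (simp only: divide_divide_eq_right)
    qed
    also have "(e + ?H\<^sup>2 / (2 * h)) * w \<le> (h / 4 + h / 2) * w"
    proof (intro mult_right_mono add_mono w0)
      \<comment> \<open>Adding the two half-step bounds gives \<open>?H \<le> L + R\<close>.\<close>
      have "?H * ?H \<le> h * (L + R)"
        using H h coef(3,4) by (intro mult_mono) auto
      then show "e \<le> h / 4"
        using pos by (simp add: e_def field_simps power2_eq_square)
      have "?H * ?H \<le> h * h"
        using H h by (intro mult_mono) auto
      then show "?H\<^sup>2 / (2 * h) \<le> h / 2"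
        using h by (simp add: field_simps power2_eq_square)
    qed
    finally show ?thesis
      unfolding eq using e by (simp add: abs_mult)
  qed
qed

text \<open>The interval is cut into quarters: the inner mean value points are at most
  \<open>h / 2\<close> apart and the outer ones at most \<open>h\<close>, which gives
  \<open>w + 2 * w\<close>. Cutting into halves would give the constant 1/2 in place of 3/8.\<close>

lemma midpoint_difference_bound:
  fixes \<phi> \<phi>' :: "real \<Rightarrow> real"
  assumes x: "is_partition m a b x" and h: "0 < h" "step m x i \<le> h"
    and mvt: "\<And>p q. a \<le> p \<Longrightarrow> p \<le> q \<Longrightarrow> q \<le> b \<Longrightarrow> \<exists>\<xi>\<in>{p..q}. \<phi> q - \<phi> p = (q - p) * \<phi>' \<xi>"
    and w: "\<And>p q. p \<in> {a..b} \<Longrightarrow> q \<in> {a..b} \<Longrightarrow> dist p q \<le> h / 2 \<Longrightarrow> \<bar>\<phi>' p - \<phi>' q\<bar> \<le> w"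
  shows "\<bar>\<phi> (midpt m x i) - (\<phi> (node m x (i - 1)) + \<phi> (node m x i)) / 2\<bar> \<le> 3 / 8 * h * w"
proof -
  have w0: "0 \<le> w"
    using w[OF midpt_in_interval[OF x] midpt_in_interval[OF x]] h by (smt (verit) dist_self half_gt_zero)
  define \<delta> where "\<delta> = step m x i / 4"
  define s where "s = midpt m x i"
  have \<delta>: "0 \<le> \<delta>" "4 * \<delta> \<le> h"
    using step_nonneg[OF x, of i] h by (simp_all add: \<delta>_def)
  have ends: "node m x (i - 1) = s - 2 * \<delta>" "node m x i = s + 2 * \<delta>"
    by (simp_all add: s_def \<delta>_def midpt_def step_def field_simps)
  have ab: "a \<le> s - 2 * \<delta>" "s + 2 * \<delta> \<le> b"
    using node_in_interval[OF x] by (auto simp flip: ends)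
  have steps: "\<exists>\<xi>\<in>{p..p + \<delta>}. \<phi> (p + \<delta>) - \<phi> p = \<delta> * \<phi>' \<xi>" if "s - 2 * \<delta> \<le> p" "p \<le> s + \<delta>" for p
    using mvt[of p "p + \<delta>"] that ab \<delta> by auto
  obtain x1 where x1: "x1 \<in> {s - 2 * \<delta>..s - \<delta>}" "\<phi> (s - \<delta>) - \<phi> (s - 2 * \<delta>) = \<delta> * \<phi>' x1"
    using steps[of "s - 2 * \<delta>"] \<delta> by auto
  obtain x2 where x2: "x2 \<in> {s - \<delta>..s}" "\<phi> s - \<phi> (s - \<delta>) = \<delta> * \<phi>' x2"
    using steps[of "s - \<delta>"] \<delta> by auto
  obtain x3 where x3: "x3 \<in> {s..s + \<delta>}" "\<phi> (s + \<delta>) - \<phi> s = \<delta> * \<phi>' x3"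
    using steps[of s] \<delta> by auto
  obtain x4 where x4: "x4 \<in> {s + \<delta>..s + 2 * \<delta>}" "\<phi> (s + 2 * \<delta>) - \<phi> (s + \<delta>) = \<delta> * \<phi>' x4"
    using steps[of "s + \<delta>"] \<delta> by (auto simp: add.assoc simp flip: mult_2)
  have inner: "\<bar>\<phi>' x2 - \<phi>' x3\<bar> \<le> w"
    using x2(1) x3(1) ab \<delta> by (intro w) (auto simp: dist_real_def)
  have outer: "\<bar>\<phi>' x1 - \<phi>' x4\<bar> \<le> real 2 * w"
    by (rule bounded_increment_chain[of "{a..b}" "h / 2"])
       (use w h x1(1) x4(1) ab \<delta> in \<open>auto simp: dist_real_def\<close>)
  have "2 * (\<phi> s - (\<phi> (s - 2 * \<delta>) + \<phi> (s + 2 * \<delta>)) / 2)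
      = \<delta> * ((\<phi>' x2 - \<phi>' x3) + (\<phi>' x1 - \<phi>' x4))"
    using x1(2) x2(2) x3(2) x4(2) by (simp add: algebra_simps)
  then have "2 * \<bar>\<phi> s - (\<phi> (s - 2 * \<delta>) + \<phi> (s + 2 * \<delta>)) / 2\<bar>
      = \<delta> * \<bar>(\<phi>' x2 - \<phi>' x3) + (\<phi>' x1 - \<phi>' x4)\<bar>"
    using \<delta>(1) by (metis abs_mult abs_of_nonneg abs_numeral)
  also have "\<dots> \<le> h / 4 * (w + 2 * w)"
    using inner outer \<delta> w0 by (intro mult_mono order_trans[OF abs_triangle_ineq] add_mono) auto
  finally show ?thesis
    unfolding ends s_def[symmetric] by simp
qed

section \<open>Mean values and increments of the partial derivatives\<close>

lemma partial_x_mvt: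
  assumes f: "C1_on ({a..b} \<times> {c..d}) f" and t: "t \<in> {c..d}" and pq: "a \<le> p" "p \<le> q" "q \<le> b"
  shows "\<exists>\<xi>\<in>{p..q}. f (q, t) - f (p, t) = (q - p) * partial_x ({a..b} \<times> {c..d}) f (\<xi>, t)"
proof (rule mvt_very_simple[OF pq(2)])
  fix s assume s: "p \<le> s" "s \<le> q"
  have "((\<lambda>s. (s, t)) has_derivative (\<lambda>k. (k, 0))) (at s within {p..q})"
    by (auto intro!: derivative_eq_intros)
  moreover have "(f has_derivative (\<lambda>(k, l). k * partial_x ({a..b} \<times> {c..d}) f (s, t)
      + l * partial_y ({a..b} \<times> {c..d}) f (s, t))) (at (s, t) within (\<lambda>s. (s, t)) ` {p..q})"
    by (rule has_derivative_subset[OF C1_on_has_derivative[OF f]]) (use s t pq in auto)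
  ultimately show "((\<lambda>s. f (s, t)) has_derivative (\<lambda>k. k * partial_x ({a..b} \<times> {c..d}) f (s, t)))
      (at s within {p..q})"
    using has_derivative_in_compose by fastforce
qed

lemma partial_y_mvt:
  assumes f: "C1_on ({a..b} \<times> {c..d}) f" and s: "s \<in> {a..b}" and pq: "c \<le> p" "p \<le> q" "q \<le> d"
  shows "\<exists>\<xi>\<in>{p..q}. f (s, q) - f (s, p) = (q - p) * partial_y ({a..b} \<times> {c..d}) f (s, \<xi>)"
proof (rule mvt_very_simple[OF pq(2)])
  fix t assume t: "p \<le> t" "t \<le> q"
  have "((\<lambda>t. (s, t)) has_derivative (\<lambda>k. (0, k))) (at t within {p..q})"
    by (auto intro!: derivative_eq_intros)
  moreover have "(f has_derivative (\<lambda>(k, l). k * partial_x ({a..b} \<times> {c..d}) f (s, t)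
      + l * partial_y ({a..b} \<times> {c..d}) f (s, t))) (at (s, t) within (\<lambda>t. (s, t)) ` {p..q})"
    by (rule has_derivative_subset[OF C1_on_has_derivative[OF f]]) (use s t pq in auto)
  ultimately show "((\<lambda>t. f (s, t)) has_derivative (\<lambda>k. k * partial_y ({a..b} \<times> {c..d}) f (s, t)))
      (at t within {p..q})"
    using has_derivative_in_compose by fastforce
qed

lemma partial_increment_bound:
  assumes f: "C1_on ({a..b} \<times> {c..d}) f" and MP: "M \<in> {a..b} \<times> {c..d}" "P \<in> {a..b} \<times> {c..d}" "dist M P \<le> t"
  shows "\<bar>partial_x ({a..b} \<times> {c..d}) f M - partial_x ({a..b} \<times> {c..d}) f P\<bar>
           \<le> modulus_deriv ({a..b} \<times> {c..d}) 1 f t"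
    and "\<bar>partial_y ({a..b} \<times> {c..d}) f M - partial_y ({a..b} \<times> {c..d}) f P\<bar>
           \<le> modulus_deriv ({a..b} \<times> {c..d}) 1 f t"
proof -
  have S: "compact ({a..b} \<times> {c..d})"
    by (intro compact_Times compact_Icc)
  have "continuous_on ({a..b} \<times> {c..d}) (partial_x ({a..b} \<times> {c..d}) f)"
    "continuous_on ({a..b} \<times> {c..d}) (partial_y ({a..b} \<times> {c..d}) f)"
    using f by (simp_all add: C1_on_def)
  from this[THEN modulus_bound[OF S _ MP]]
  show "\<bar>partial_x ({a..b} \<times> {c..d}) f M - partial_x ({a..b} \<times> {c..d}) f P\<bar>
           \<le> modulus_deriv ({a..b} \<times> {c..d}) 1 f t"
    and "\<bar>partial_y ({a..b} \<times> {c..d}) f M - partial_y ({a..b} \<times> {c..d}) f P\<bar>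
           \<le> modulus_deriv ({a..b} \<times> {c..d}) 1 f t"
    unfolding modulus_deriv_one by linarith+
qed

lemma partial_section_increment_bound:
  assumes f: "C1_on ({a..b} \<times> {c..d}) f"
  shows "t \<in> {c..d} \<Longrightarrow> p \<in> {a..b} \<Longrightarrow> q \<in> {a..b} \<Longrightarrow> dist p q \<le> r \<Longrightarrow>
      \<bar>partial_x ({a..b} \<times> {c..d}) f (p, t) - partial_x ({a..b} \<times> {c..d}) f (q, t)\<bar>
        \<le> modulus_deriv ({a..b} \<times> {c..d}) 1 f r"
    and "s \<in> {a..b} \<Longrightarrow> p \<in> {c..d} \<Longrightarrow> q \<in> {c..d} \<Longrightarrow> dist p q \<le> r \<Longrightarrow>
      \<bar>partial_y ({a..b} \<times> {c..d}) f (s, p) - partial_y ({a..b} \<times> {c..d}) f (s, q)\<bar>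
        \<le> modulus_deriv ({a..b} \<times> {c..d}) 1 f r"
  using partial_increment_bound(1)[OF f, of "(p, t)" "(q, t)" r]
    partial_increment_bound(2)[OF f, of "(s, p)" "(s, q)" r]
  by (simp_all add: dist_Pair_Pair)

section \<open>The coefficient functionals compared with point values\<close>

lemma mu_bound:
  assumes x: "is_partition m a b x" and y: "is_partition n c d y" and f: "C1_on ({a..b} \<times> {c..d}) f"
  defines "h \<equiv> mesh_size m n x y"
  shows "\<bar>mu m n x y f i j - f (midpt m x i, midpt n y j)\<bar>
           \<le> 3 / 2 * h * modulus_deriv ({a..b} \<times> {c..d}) 1 f (h / 2)"
proof -
  let ?w = "modulus_deriv ({a..b} \<times> {c..d}) 1 f (h / 2)"
  let ?s = "midpt m x" and ?t = "midpt n y"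
  have h: "0 < h" "step m x i \<le> h" "step n y j \<le> h"
    unfolding h_def by (rule mesh_size_pos[OF x y] step_le_mesh_size[OF x y])+
  have s: "?s i \<in> {a..b}" and t: "?t j \<in> {c..d}"
    by (rule midpt_in_interval[OF x], rule midpt_in_interval[OF y])
  have X: "\<bar>coef_a m x i * (f (?s (i - 1), ?t j) - f (?s i, ?t j))
      + coef_c m x i * (f (?s (i + 1), ?t j) - f (?s i, ?t j))\<bar> \<le> 3 / 4 * h * ?w"
    by (rule second_difference_bound[where \<phi> = "\<lambda>s. f (s, ?t j)"
          and \<phi>' = "\<lambda>s. partial_x ({a..b} \<times> {c..d}) f (s, ?t j)",
          OF x h(1,2) partial_x_mvt[OF f t] partial_section_increment_bound(1)[OF f t]])
  have Y: "\<bar>coef_a n y j * (f (?s i, ?t (j - 1)) - f (?s i, ?t j))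
      + coef_c n y j * (f (?s i, ?t (j + 1)) - f (?s i, ?t j))\<bar> \<le> 3 / 4 * h * ?w"
    by (rule second_difference_bound[where \<phi> = "\<lambda>t. f (?s i, t)"
          and \<phi>' = "\<lambda>t. partial_y ({a..b} \<times> {c..d}) f (?s i, t)",
          OF y h(1,3) partial_y_mvt[OF f s] partial_section_increment_bound(2)[OF f s]])
  \<comment> \<open>The choice of \<open>coef_b\<close> makes the weights sum to 1, so the
    functional is the point value plus one second difference in each direction.\<close>
  have split: "mu m n x y f i j - f (?s i, ?t j)
    = (coef_a m x i * (f (?s (i - 1), ?t j) - f (?s i, ?t j))
      + coef_c m x i * (f (?s (i + 1), ?t j) - f (?s i, ?t j)))
    + (coef_a n y j * (f (?s i, ?t (j - 1)) - f (?s i, ?t j))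
      + coef_c n y j * (f (?s i, ?t (j + 1)) - f (?s i, ?t j)))"
    unfolding mu_def coef_b_def Let_def by algebra
  show ?thesis
    unfolding split by (rule order_trans[OF abs_triangle_ineq order_trans[OF add_mono[OF X Y]]]) simp
qed

lemma mu_star_bound:
  assumes x: "is_partition m a b x" and y: "is_partition n c d y" and f: "C1_on ({a..b} \<times> {c..d}) f"
  defines "h \<equiv> mesh_size m n x y"
  shows "\<bar>mu_star m n x y f i j - f (midpt m x i, midpt n y j)\<bar>
           \<le> 3 / 4 * h * modulus_deriv ({a..b} \<times> {c..d}) 1 f (h / 2)"
proof -
  let ?w = "modulus_deriv ({a..b} \<times> {c..d}) 1 f (h / 2)"
  let ?s = "midpt m x i" and ?t = "midpt n y j"
  let ?p = "node m x (i - 1)" and ?q = "node m x i" and ?r = "node n y (j - 1)" and ?u = "node n y j"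
  have h: "0 < h" "step m x i \<le> h" "step n y j \<le> h"
    unfolding h_def by (rule mesh_size_pos[OF x y] step_le_mesh_size[OF x y])+
  have t: "?t \<in> {c..d}"
    by (rule midpt_in_interval[OF y])
  have X: "\<bar>f (?s, ?t) - (f (?p, ?t) + f (?q, ?t)) / 2\<bar> \<le> 3 / 8 * h * ?w"
    by (rule midpoint_difference_bound[where \<phi> = "\<lambda>s. f (s, ?t)"
          and \<phi>' = "\<lambda>s. partial_x ({a..b} \<times> {c..d}) f (s, ?t)",
          OF x h(1,2) partial_x_mvt[OF f t] partial_section_increment_bound(1)[OF f t]])
  have Y: "\<bar>f (s, ?t) - (f (s, ?r) + f (s, ?u)) / 2\<bar> \<le> 3 / 8 * h * ?w" if s: "s \<in> {a..b}" for s
    by (rule midpoint_difference_bound[where \<phi> = "\<lambda>t. f (s, t)"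
          and \<phi>' = "\<lambda>t. partial_y ({a..b} \<times> {c..d}) f (s, t)",
          OF y h(1,3) partial_y_mvt[OF f s] partial_section_increment_bound(2)[OF f s]])
  \<comment> \<open>Here \<open>p\<close> and \<open>q\<close> stand for the values at the midpoints
    of the two vertical edges. They cancel, leaving one midpoint difference in x and the mean of two
    in y.\<close>
  have regroup: "2 * z - 1 / 4 * (p1 + p2 + q1 + q2) - z
      = (z - (p + q) / 2) + ((p - (p1 + p2) / 2) + (q - (q1 + q2) / 2)) / 2"
    for z p q p1 p2 q1 q2 :: real
    by (simp add: field_simps)
  have average: "\<bar>p + (q + r) / 2\<bar> \<le> 2 * e" if "\<bar>p\<bar> \<le> e" "\<bar>q\<bar> \<le> e" "\<bar>r\<bar> \<le> e"
    for p q r e :: real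
    using that unfolding add_divide_distrib by linarith
  have split: "mu_star m n x y f i j - f (?s, ?t) = (f (?s, ?t) - (f (?p, ?t) + f (?q, ?t)) / 2)
      + ((f (?p, ?t) - (f (?p, ?r) + f (?p, ?u)) / 2) + (f (?q, ?t) - (f (?q, ?r) + f (?q, ?u)) / 2)) / 2"
    unfolding mu_star_def Let_def by (rule regroup)
  show ?thesis
    unfolding split
    by (rule order_trans[OF average[OF X Y[OF node_in_interval[OF x]] Y[OF node_in_interval[OF x]]]]) simp
qed

section \<open>The error estimate for both operators\<close>

text \<open>Only the distance of the functionals from evaluation at the midpoints enters, as
  \<open>K\<close>, so one argument serves both operators. The remaining 5/4 is the cost of
  averaging the midpoint values.\<close>

lemma quasi_interpolant_error:
  assumes x: "is_partition m a b x" and y: "is_partition n c d y"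
    and u: "extends_partition m x u" and v: "extends_partition n y v"
    and B: "\<And>i j. i \<in> {0..m+1} \<Longrightarrow> j \<in> {0..n+1} \<Longrightarrow> is_classical_bspline m n u v i j (Bbar i j)"
    and f: "C1_on ({a..b} \<times> {c..d}) f" and P: "P \<in> {a..b} \<times> {c..d}"
    and h: "h = mesh_size m n x y" and w: "w = modulus_deriv ({a..b} \<times> {c..d}) 1 f (h / 2)"
    and \<nu>: "\<And>i j. \<bar>\<nu> i j - f (midpt m x i, midpt n y j)\<bar> \<le> K * h * w"
  shows "\<bar>f P - (\<Sum>i=0..m+1. \<Sum>j=0..n+1. \<nu> i j * bspline m n u v Bbar i j P)\<bar> \<le> (K + 5 / 4) * h * w"
proof -
  let ?\<Omega> = "{a..b} \<times> {c..d}" and ?B = "\<lambda>i j. bspline m n u v Bbar i j P"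
  let ?s = "midpt m x" and ?t = "midpt n y"
  let ?sum = "\<lambda>F. \<Sum>i=0..m+1. \<Sum>j=0..n+1. ?B i j * F i j"
  have h0: "0 < h" using mesh_size_pos[OF x y] h by simp
  have w0: "0 \<le> w"
    using partial_increment_bound(1)[OF f P P, of "h / 2"] h0 w by simp
  have convex: "convex ?\<Omega>"
    by (intro convex_Times) auto
  note inc = partial_increment_bound[OF f, of _ _ "h / 2", folded w]
  obtain cx where cx: "\<And>Z. Z \<in> ?\<Omega> \<Longrightarrow> \<bar>partial_x ?\<Omega> f Z - cx\<bar> \<le> (1 / 2 + dist Z P / (h / 2)) * w"
    by (rule bounded_increment_centre[of ?\<Omega> "h / 2" "partial_x ?\<Omega> f" w P])
       (use convex h0 inc(1) P in auto)
  obtain cy where cy: "\<And>Z. Z \<in> ?\<Omega> \<Longrightarrow> \<bar>partial_y ?\<Omega> f Z - cy\<bar> \<le> (1 / 2 + dist Z P / (h / 2)) * w"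
    by (rule bounded_increment_centre[of ?\<Omega> "h / 2" "partial_y ?\<Omega> f" w P])
       (use convex h0 inc(2) P in auto)
  have nonneg: "?B i j \<ge> 0" if "i \<in> {0..m+1}" "j \<in> {0..n+1}" for i j
    using bspline_reproduction(1)[OF x y u v B P that] .
  have Sx: "?sum (\<lambda>i j. c0 + c1 * ?s i + c2 * (node m x (i - 1) * node m x i))
      = c0 + c1 * fst P + c2 * (fst P)\<^sup>2" for c0 c1 c2
    by (rule bspline_reproduction(2)[OF x y u v B P])
  have Sy: "?sum (\<lambda>i j. c0 + c1 * ?t j + c2 * (node n y (j - 1) * node n y j))
      = c0 + c1 * snd P + c2 * (snd P)\<^sup>2" for c0 c1 c2
    by (rule bspline_reproduction(3)[OF x y u v B P])
  have add: "?sum (\<lambda>i j. F i j + G i j) = ?sum F + ?sum G" for F G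
    by (simp add: distrib_left sum.distrib)
  have scale: "?sum (\<lambda>i j. r * F i j) = r * ?sum F" for r F
    by (simp add: sum_distrib_left mult_ac)
  have mono: "?sum F \<le> ?sum G" if "\<And>i j. F i j \<le> G i j" for F G
    using that nonneg by (intro sum_mono mult_left_mono) auto
  have const: "?sum (\<lambda>_ _. r) = r" for r
    using Sx[of r 0 0] by simp
  have sqx: "?sum (\<lambda>i j. (?s i - fst P)\<^sup>2) \<le> h\<^sup>2 / 4"
  proof -
    \<comment> \<open>A squared midpoint exceeds the product of its two nodes by a quarter of the
      squared step, which leaves a reproducible quadratic plus at most
      \<open>h\<^sup>2 / 4\<close>.\<close>
    have "(?s i - fst P)\<^sup>2 \<le> (h\<^sup>2 / 4 + (fst P)\<^sup>2) + (- 2 * fst P) * ?s i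
        + 1 * (node m x (i - 1) * node m x i)" for i
    proof -
      have "(step m x i)\<^sup>2 \<le> h\<^sup>2"
        using step_nonneg[OF x, of i] step_le_mesh_size(1)[OF x y, of i] h by (intro power_mono) auto
      moreover have "(?s i)\<^sup>2 = node m x (i - 1) * node m x i + (step m x i)\<^sup>2 / 4"
        by (simp add: midpt_def step_def field_simps power2_eq_square)
      ultimately show ?thesis
        by (simp add: power2_diff)
    qed
    then have "?sum (\<lambda>i j. (?s i - fst P)\<^sup>2) \<le> ?sum (\<lambda>i j. (h\<^sup>2 / 4 + (fst P)\<^sup>2) + (- 2 * fst P) * ?s i
        + 1 * (node m x (i - 1) * node m x i))"
      by (rule mono)
    also have "\<dots> = h\<^sup>2 / 4"
      unfolding Sx by (simp add: power2_eq_square)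
    finally show ?thesis .
  qed
  have sqy: "?sum (\<lambda>i j. (?t j - snd P)\<^sup>2) \<le> h\<^sup>2 / 4"
  proof -
    have "(?t j - snd P)\<^sup>2 \<le> (h\<^sup>2 / 4 + (snd P)\<^sup>2) + (- 2 * snd P) * ?t j
        + 1 * (node n y (j - 1) * node n y j)" for j
    proof -
      have "(step n y j)\<^sup>2 \<le> h\<^sup>2"
        using step_nonneg[OF y, of j] step_le_mesh_size(2)[OF x y, of j] h by (intro power_mono) auto
      moreover have "(?t j)\<^sup>2 = node n y (j - 1) * node n y j + (step n y j)\<^sup>2 / 4"
        by (simp add: midpt_def step_def field_simps power2_eq_square)
      ultimately show ?thesis
        by (simp add: power2_diff)
    qed
    then have "?sum (\<lambda>i j. (?t j - snd P)\<^sup>2) \<le> ?sum (\<lambda>i j. (h\<^sup>2 / 4 + (snd P)\<^sup>2) + (- 2 * snd P) * ?t j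
        + 1 * (node n y (j - 1) * node n y j))"
      by (rule mono)
    also have "\<dots> = h\<^sup>2 / 4"
      unfolding Sy by (simp add: power2_eq_square)
    finally show ?thesis .
  qed
  define E where "E i j = \<nu> i j - f P - (cx * (?s i - fst P) + cy * (?t j - snd P))" for i j
  have E: "\<bar>E i j\<bar> \<le> (K * h * w + w * h / 4) + 2 * w / h * ((?s i - fst P)\<^sup>2 + (?t j - snd P)\<^sup>2)" for i j
  proof -
    have "(?s i, ?t j) \<in> ?\<Omega>"
      using midpt_in_interval[OF x, of i] midpt_in_interval[OF y, of j] by simp
    from C1_linear_approximation[OF f _ _ h0 w0 this P cx cy]
    have inc: "\<bar>f (?s i, ?t j) - f P - (cx * (?s i - fst P) + cy * (?t j - snd P))\<bar>
        \<le> w * (2 * ((?s i - fst P)\<^sup>2 + (?t j - snd P)\<^sup>2) / h + h / 4)"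
      by simp
    have split: "E i j = (\<nu> i j - f (?s i, ?t j))
        + (f (?s i, ?t j) - f P - (cx * (?s i - fst P) + cy * (?t j - snd P)))"
      by (simp add: E_def)
    have "\<bar>E i j\<bar> \<le> K * h * w + w * (2 * ((?s i - fst P)\<^sup>2 + (?t j - snd P)\<^sup>2) / h + h / 4)"
      unfolding split by (rule order_trans[OF abs_triangle_ineq add_mono[OF \<nu> inc]])
    also have "\<dots> = (K * h * w + w * h / 4) + 2 * w / h * ((?s i - fst P)\<^sup>2 + (?t j - snd P)\<^sup>2)"
      by (simp add: distrib_left add_divide_distrib mult_ac)
    finally show ?thesis .
  qed
  \<comment> \<open>Reproduction of constants and linear functions removes the gradient part,
    whatever \<open>cx\<close> and \<open>cy\<close> are.\<close>
  have "?sum (\<lambda>i j. cx * (?s i - fst P))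
      = ?sum (\<lambda>i j. - cx * fst P + cx * ?s i + 0 * (node m x (i - 1) * node m x i))"
    by (intro sum.cong refl) (simp add: algebra_simps)
  then have lin_x: "?sum (\<lambda>i j. cx * (?s i - fst P)) = 0"
    unfolding Sx by simp
  have "?sum (\<lambda>i j. cy * (?t j - snd P))
      = ?sum (\<lambda>i j. - cy * snd P + cy * ?t j + 0 * (node n y (j - 1) * node n y j))"
    by (intro sum.cong refl) (simp add: algebra_simps)
  then have lin_y: "?sum (\<lambda>i j. cy * (?t j - snd P)) = 0"
    unfolding Sy by simp
  have "?sum \<nu> = ?sum (\<lambda>i j. E i j + (f P + (cx * (?s i - fst P) + cy * (?t j - snd P))))"
    by (simp add: E_def)
  then have \<nu>E: "?sum \<nu> = ?sum E + f P"
    unfolding add const lin_x lin_y by simp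
  have "\<bar>?sum E\<bar> \<le> ?sum (\<lambda>i j. \<bar>E i j\<bar>)"
    using nonneg by (intro order_trans[OF sum_abs] sum_mono order_trans[OF sum_abs])
      (auto simp: abs_mult)
  also have "\<dots> \<le> ?sum (\<lambda>i j. (K * h * w + w * h / 4) + 2 * w / h * ((?s i - fst P)\<^sup>2 + (?t j - snd P)\<^sup>2))"
    by (rule mono[OF E])
  also have "\<dots> = K * h * w + w * h / 4
      + 2 * w / h * (?sum (\<lambda>i j. (?s i - fst P)\<^sup>2) + ?sum (\<lambda>i j. (?t j - snd P)\<^sup>2))"
    unfolding add scale const by simp
  \<comment> \<open>The constant 5/4 is 1/4 from the constant term plus
    \<open>2 * (1 / 4 + 1 / 4)\<close> from the two second moments.\<close>
  also have "\<dots> \<le> K * h * w + w * h / 4 + 2 * w / h * (h\<^sup>2 / 4 + h\<^sup>2 / 4)"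
    using h0 w0 by (intro add_left_mono mult_left_mono add_mono sqx sqy) auto
  also have "\<dots> = (K + 5 / 4) * h * w"
    using h0 by (simp add: field_simps power2_eq_square)
  finally have "\<bar>?sum E\<bar> \<le> (K + 5 / 4) * h * w" .
  then show ?thesis
    using \<nu>E by (simp add: mult.commute[of "\<nu> _ _"])
qed

theorem theorem2:
  fixes m n :: int and a b c d :: real
    and x y u v :: "int \<Rightarrow> real"
    and Bbar :: "int \<Rightarrow> int \<Rightarrow> real \<times> real \<Rightarrow> real"
    and \<Omega> :: "(real \<times> real) set"
  assumes "is_partition m a b x" and "is_partition n c d y"
    and "extends_partition m x u" and "extends_partition n y v"
    and "\<And>i j. i \<in> {0..m+1} \<Longrightarrow> j \<in> {0..n+1} \<Longrightarrow> is_classical_bspline m n u v i j (Bbar i j)"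
    and "\<Omega> = {a..b} \<times> {c..d}"
  shows "(\<exists>C1>0. C1 \<le> 3 \<and>
            (\<forall>f. C1_on \<Omega> f \<longrightarrow>
               sup_norm \<Omega> (\<lambda>P. f P - S2 m n x y u v Bbar f P)
                 \<le> C1 * mesh_size m n x y * modulus_deriv \<Omega> 1 f (mesh_size m n x y / 2)))
       \<and> (\<exists>C1>0. C1 \<le> 2 \<and>
            (\<forall>f. C1_on \<Omega> f \<longrightarrow>
               sup_norm \<Omega> (\<lambda>P. f P - W2_star m n x y u v Bbar f P)
                 \<le> C1 * mesh_size m n x y * modulus_deriv \<Omega> 1 f (mesh_size m n x y / 2)))"
proof -
  let ?h = "mesh_size m n x y"
  have error: "sup_norm \<Omega> (\<lambda>P. f P - (\<Sum>i=0..m+1. \<Sum>j=0..n+1. \<nu> i j * bspline m n u v Bbar i j P))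
      \<le> (K + 5 / 4) * ?h * modulus_deriv \<Omega> 1 f (?h / 2)"
    if f: "C1_on \<Omega> f"
      and \<nu>: "\<And>i j. \<bar>\<nu> i j - f (midpt m x i, midpt n y j)\<bar> \<le> K * ?h * modulus_deriv \<Omega> 1 f (?h / 2)"
    for f \<nu> K
    unfolding sup_norm_def
  proof (rule cSUP_least)
    show "\<Omega> \<noteq> {}"
      using assms(6) node_in_interval[OF assms(1), of 0] node_in_interval[OF assms(2), of 0] by auto
    fix P assume "P \<in> \<Omega>"
    then have P: "P \<in> {a..b} \<times> {c..d}"
      by (simp add: assms(6))
    show "\<bar>f P - (\<Sum>i=0..m+1. \<Sum>j=0..n+1. \<nu> i j * bspline m n u v Bbar i j P)\<bar>
        \<le> (K + 5 / 4) * ?h * modulus_deriv \<Omega> 1 f (?h / 2)"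
      unfolding assms(6)
      by (rule quasi_interpolant_error[OF assms(1-5) f[unfolded assms(6)] P refl refl
            \<nu>[unfolded assms(6)]])
  qed
  have "sup_norm \<Omega> (\<lambda>P. f P - S2 m n x y u v Bbar f P)
      \<le> (3 / 2 + 5 / 4) * ?h * modulus_deriv \<Omega> 1 f (?h / 2)" if "C1_on \<Omega> f" for f
    unfolding S2_def
    by (rule error[OF that]) (use mu_bound[OF assms(1,2)] that in \<open>simp add: assms(6)\<close>)
  moreover have "sup_norm \<Omega> (\<lambda>P. f P - W2_star m n x y u v Bbar f P)
      \<le> (3 / 4 + 5 / 4) * ?h * modulus_deriv \<Omega> 1 f (?h / 2)" if "C1_on \<Omega> f" for f
    unfolding W2_star_def
    by (rule error[OF that]) (use mu_star_bound[OF assms(1,2)] that in \<open>simp add: assms(6)\<close>)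
  ultimately show ?thesis
    by (intro conjI exI[of _ "3 / 2 + 5 / 4 :: real"] exI[of _ "3 / 4 + 5 / 4 :: real"]) auto
qed

end
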